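(* For each of the following pairs $(m,w)$, with $\zeta:=e^{2\pi i/m}$, $p_1:=\zeta+\bar\zeta$, $p_5:=\zeta^5+\bar\zeta^5$, let $\Gamma\subset GL(2,\mathbb Z[\zeta])$ be the group of matrices $A$ with $\begin{pmatrix}-1&0\\0&w\end{pmatrix}=A^t\begin{pmatrix}-1&0\\0&w\end{pmatrix}\bar A$: (i) $m=12$, $w=2p_1(p_1+2)$; (ii) $m=10$, $w=2p_1^3$; (iii) $m=18$, $w=p_1(p_1+2)$; (iv) $m=14$, $w=(-p_5)^{-1}$; (v) $m=12$, $w=(p_1+1)^{-1}$. Then the image of $\Gamma$ in $PGL(2,\mathbb C)$ is a Schwarzian triangle group of type (i) $(2,12,12)$, (ii) $(2,10,10)$, (iii) $(2,3,18)$, (iv) $(2,3,14)$, (v) $(2,3,12)$ respectively.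
   Context: $GL(2,\mathbb C)$ acts on $\mathbb P^1\mathbb C$ by linear fractional transformations, giving the image in $PGL(2,\mathbb C)$. A (Schwarzian) triangle group of type $(a,b,c)$ is a group of linear fractional transformations preserving a disc (or half plane), generated by the rotations by angles $2\pi/a$ and $2\pi/b$ around two vertices of a hyperbolic triangle with angles $\pi/a,\pi/b,\pi/c$ (whose product is then a rotation by $2\pi/c$ around the third vertex). *)

theory Defs
  imports "HOL-Analysis.Analysis" "HOL-Computational_Algebra.Polynomial"
begin

definition mat2 :: "complex \<Rightarrow> complex \<Rightarrow> complex \<Rightarrow> complex \<Rightarrow> complex^2^2" where
  "mat2 a b c d = (\<chi> i j. if i = 1 then (if j = 1 then a else b) else (if j = 1 then c else d))"

definition conj_mat :: "complex^2^2 \<Rightarrow> complex^2^2" where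
  "conj_mat A = (\<chi> i j. cnj (A $ i $ j))"

definition zeta :: "nat \<Rightarrow> complex" where
  "zeta m = exp (2 * pi * \<i> / of_nat m)"

definition int_ring_gen :: "complex \<Rightarrow> complex set" where
  "int_ring_gen z = {poly (map_poly of_int p) z | p :: int poly. True}"

definition GL2 :: "complex set \<Rightarrow> (complex^2^2) set" where
  "GL2 R = {A. invertible A \<and> (\<forall>i j. A $ i $ j \<in> R) \<and> (\<forall>i j. matrix_inv A $ i $ j \<in> R)}"

definition Gamma :: "nat \<Rightarrow> complex \<Rightarrow> (complex^2^2) set" where
  "Gamma m w = {A \<in> GL2 (int_ring_gen (zeta m)).
      mat2 (-1) 0 0 w = transpose A ** mat2 (-1) 0 0 w ** conj_mat A}"

text \<open>The image of a set of matrices in PGL(2,C) = GL(2,C)/scalars, represented by the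
  set of all nonzero scalar multiples of its elements.\<close>
definition pgl_image :: "(complex^2^2) set \<Rightarrow> (complex^2^2) set" where
  "pgl_image S = {B. \<exists>A\<in>S. \<exists>c. c \<noteq> 0 \<and> B = mat c ** A}"

text \<open>The subgroup of PGL(2,C) generated by (the classes of) R1 and R2, represented
  as the set of all nonzero scalar multiples of words in R1, R2 and their inverses.\<close>
inductive_set proj_gen :: "complex^2^2 \<Rightarrow> complex^2^2 \<Rightarrow> (complex^2^2) set"
  for R1 R2 where
  scal: "c \<noteq> 0 \<Longrightarrow> mat c \<in> proj_gen R1 R2"
| mul1: "X \<in> proj_gen R1 R2 \<Longrightarrow> X ** R1 \<in> proj_gen R1 R2"
| mul2: "X \<in> proj_gen R1 R2 \<Longrightarrow> X ** R2 \<in> proj_gen R1 R2"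
| inv1: "X \<in> proj_gen R1 R2 \<Longrightarrow> X ** matrix_inv R1 \<in> proj_gen R1 R2"
| inv2: "X \<in> proj_gen R1 R2 \<Longrightarrow> X ** matrix_inv R2 \<in> proj_gen R1 R2"

text \<open>Poincare disc model (unit disc). The disc automorphism z \<mapsto> (z - v)/(1 - cnj v z)
  moves v to 0; geodesics through 0 are diameters.\<close>
definition to_origin :: "complex \<Rightarrow> complex \<Rightarrow> complex" where
  "to_origin v z = (z - v) / (1 - cnj v * z)"

definition hyp_angle :: "complex \<Rightarrow> complex \<Rightarrow> complex \<Rightarrow> real" where
  "hyp_angle v u w = \<bar>Arg (to_origin v w / to_origin v u)\<bar>"

text \<open>Matrix of the hyperbolic rotation of the unit disc about v by angle theta
  (the Moebius map z \<mapsto> to_origin v ^-1 (e^(i theta) * to_origin v z)).\<close>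
definition rot_mat :: "complex \<Rightarrow> real \<Rightarrow> complex^2^2" where
  "rot_mat v \<theta> = mat2 1 v (cnj v) 1 ** mat2 (exp (\<i> * of_real \<theta>)) 0 0 1 ** mat2 1 (- v) (- cnj v) 1"

definition hyp_triangle :: "complex \<Rightarrow> complex \<Rightarrow> complex \<Rightarrow> nat \<Rightarrow> nat \<Rightarrow> nat \<Rightarrow> bool" where
  "hyp_triangle v1 v2 v3 a b c \<longleftrightarrow>
     norm v1 < 1 \<and> norm v2 < 1 \<and> norm v3 < 1 \<and>
     v1 \<noteq> v2 \<and> v2 \<noteq> v3 \<and> v1 \<noteq> v3 \<and>
     hyp_angle v1 v2 v3 = pi / real a \<and>
     hyp_angle v2 v3 v1 = pi / real b \<and>
     hyp_angle v3 v1 v2 = pi / real c"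

text \<open>G (a subgroup of PGL(2,C), given as a scalar-closed set of matrices) is a Schwarzian
  triangle group of type (a,b,c): there is a disc D (image of the unit disc under the
  Moebius map of an invertible M^-1) and a hyperbolic triangle in D with angles
  pi/a, pi/b, pi/c such that G is generated by the rotations by 2 pi/a and 2 pi/b
  about the first two vertices (these preserve D). We transport everything to the
  unit disc via M.\<close>
definition triangle_group :: "(complex^2^2) set \<Rightarrow> nat \<Rightarrow> nat \<Rightarrow> nat \<Rightarrow> bool" where
  "triangle_group G a b c \<longleftrightarrow>
     (\<exists>M v1 v2 v3. invertible M \<and> hyp_triangle v1 v2 v3 a b c \<and>
        G = proj_gen (matrix_inv M ** rot_mat v1 (2 * pi / real a) ** M)
                     (matrix_inv M ** rot_mat v2 (2 * pi / real b) ** M))"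

end

theory Submission
  imports Defs
begin

text \<open>
  Let \<open>K = \<rat>(\<zeta>)\<close>. A matrix of \<open>\<Gamma>\<close> with first column \<open>(a, c)\<close> satisfies
  \<open>|a|\<^sup>2 = 1 + w |c|\<^sup>2\<close> and is determined by this column and its determinant, a unit of
  absolute value 1. All conjugates of \<open>w\<close> other than \<open>w\<close> itself are negative, so the other
  conjugates of \<open>|a|\<^sup>2\<close> lie in \<open>[0, 1]\<close>; hence two different values of \<open>|a|\<^sup>2\<close> differ by at
  least 1, and \<open>|a|\<^sup>2\<close> is bounded away from 1 if \<open>c \<noteq> 0\<close>.

  In each case \<open>\<Gamma>\<close> contains \<open>D = diag(\<zeta>, 1)\<close> and an involution \<open>S\<close> of \<open>PGL\<^sub>2\<close> such that \<open>S D\<close>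
  is elliptic of order \<open>q\<close> (3 or \<open>m\<close>). For \<open>A \<in> \<Gamma>\<close> with \<open>c \<noteq> 0\<close> some
  \<open>S D\<^sup>k A\<close> has a strictly smaller \<open>|a|\<^sup>2\<close>: choose \<open>k\<close> such that the two summands of its upper left
  entry point in nearly opposite directions. The descent stops at \<open>c = 0\<close>, where \<open>A\<close> is
  projectively a power of \<open>D\<close>. Therefore \<open>S\<close> and \<open>S D\<close> generate the image of \<open>\<Gamma>\<close>, and after a
  change of coordinates they are the rotations by \<open>\<pi>\<close> and \<open>2\<pi>/q\<close> about two
  vertices of a triangle with angles \<open>\<pi>/2, \<pi>/q, \<pi>/m\<close>, whose third vertex is the fixed point of \<open>D\<close>.
\<close>

section \<open>Two-by-two complex matrices\<close>

lemma mat2_sel [simp]: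
  "mat2 a b c d $ 1 $ 1 = a" "mat2 a b c d $ 1 $ 2 = b"
  "mat2 a b c d $ 2 $ 1 = c" "mat2 a b c d $ 2 $ 2 = d"
  by (simp_all add: mat2_def)

lemma mat2_eta: "A = mat2 (A $ 1 $ 1) (A $ 1 $ 2) (A $ 2 $ 1) (A $ 2 $ 2)"
  by (simp add: vec_eq_iff forall_2)

lemma mat2_cases: obtains a b c d where "A = mat2 a b c d"
  using mat2_eta by blast

lemma mat2_eq_iff [simp]:
  "mat2 a b c d = mat2 a' b' c' d' \<longleftrightarrow> a = a' \<and> b = b' \<and> c = c' \<and> d = d'"
  by (auto simp: vec_eq_iff forall_2)

lemma mat2_mult [simp]:
  "mat2 a b c d ** mat2 a' b' c' d' =
     mat2 (a * a' + b * c') (a * b' + b * d') (c * a' + d * c') (c * b' + d * d')"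
  by (simp add: vec_eq_iff forall_2 matrix_matrix_mult_def sum_2)

lemma mat_eq_mat2: "mat k = mat2 k 0 0 k"
  by (simp add: vec_eq_iff forall_2 mat_def)

lemma transpose_mat2 [simp]: "transpose (mat2 a b c d) = mat2 a c b d"
  by (simp add: vec_eq_iff forall_2 transpose_def)

lemma conj_mat_mat2 [simp]: "conj_mat (mat2 a b c d) = mat2 (cnj a) (cnj b) (cnj c) (cnj d)"
  by (simp add: vec_eq_iff forall_2 conj_mat_def)

lemma conj_mat_mult: "conj_mat (A ** B) = conj_mat A ** conj_mat B"
  by (cases A rule: mat2_cases, cases B rule: mat2_cases) simp

lemma matrix_inv_cancel:
  fixes A :: "complex^2^2"
  assumes "invertible A"
  shows "A ** matrix_inv A = mat 1" "matrix_inv A ** A = mat 1"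
  using someI_ex[OF assms[unfolded invertible_def]] by (auto simp: matrix_inv_def)

lemma matrix_inv_eqI:
  fixes A B :: "complex^2^2"
  assumes "A ** B = mat 1" "B ** A = mat 1"
  shows "invertible A" "matrix_inv A = B"
proof -
  show inv: "invertible A"
    using assms by (auto simp: invertible_def)
  show "matrix_inv A = B"
    by (metis assms(1) inv matrix_inv_cancel(2) matrix_mul_assoc matrix_mul_lid matrix_mul_rid)
qed

lemma matrix_inv_mat2:
  assumes "a * d - b * c \<noteq> 0"
  defines "e \<equiv> inverse (a * d - b * c)"
  shows "invertible (mat2 a b c d)"
    and "matrix_inv (mat2 a b c d) = mat2 (e * d) (- e * b) (- e * c) (e * a)"
proof -
  have e: "e * (a * d - b * c) = 1"
    using assms by simp
  have "mat2 a b c d ** mat2 (e * d) (- e * b) (- e * c) (e * a) = mat 1"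
       "mat2 (e * d) (- e * b) (- e * c) (e * a) ** mat2 a b c d = mat 1"
    using e by (simp_all add: mat_eq_mat2 algebra_simps)
  then show "invertible (mat2 a b c d)"
    and "matrix_inv (mat2 a b c d) = mat2 (e * d) (- e * b) (- e * c) (e * a)"
    by (rule matrix_inv_eqI)+
qed

lemma invertible_mat2_iff: "invertible (mat2 a b c d) \<longleftrightarrow> a * d - b * c \<noteq> 0"
  by (simp add: invertible_det_nz det_2)

lemma mat_mult_commute: "mat k ** A = A ** mat (k::complex)" for A :: "complex^2^2"
  by (cases A rule: mat2_cases) (simp add: mat_eq_mat2)

lemma mat_mult_left_commute: "A ** (mat k ** B) = mat k ** (A ** B)" for A B :: "complex^2^2"
  by (metis mat_mult_commute matrix_mul_assoc)

lemma mat_mult_mat: "mat k ** mat l = (mat (k * l) :: complex^2^2)"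
  by (simp add: mat_eq_mat2)

lemma matrix_inv_mult:
  fixes A B :: "complex^2^2"
  assumes "invertible A" "invertible B"
  shows "matrix_inv (A ** B) = matrix_inv B ** matrix_inv A"
proof (rule matrix_inv_eqI)
  show "A ** B ** (matrix_inv B ** matrix_inv A) = mat 1"
    by (metis assms matrix_inv_cancel(1) matrix_mul_assoc matrix_mul_rid)
  show "matrix_inv B ** matrix_inv A ** (A ** B) = mat 1"
    by (metis assms matrix_inv_cancel(2) matrix_mul_assoc matrix_mul_rid)
qed

subsection \<open>Subgroups of the projective linear group\<close>

lemma invertible_mat: "k \<noteq> 0 \<Longrightarrow> invertible (mat k :: complex^2^2)"
  by (simp add: mat_eq_mat2 invertible_mat2_iff)

lemma matrix_inv_mat: "k \<noteq> 0 \<Longrightarrow> matrix_inv (mat k :: complex^2^2) = mat (inverse k)"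
  by (rule matrix_inv_eqI) (simp_all add: mat_eq_mat2)

lemma invertible_matrix_inv:
  fixes A :: "complex^2^2"
  assumes "invertible A"
  shows "invertible (matrix_inv A)" "matrix_inv (matrix_inv A) = A"
  using matrix_inv_eqI[of "matrix_inv A" A] matrix_inv_cancel[OF assms] by auto

text \<open>Words grow only on the right, so the induction runs over the right factor
  \<open>Y\<close>. If \<open>Y\<close> is a scalar, a second induction over \<open>X\<close> moves
  it leftwards through the generators, scalar matrices being central.\<close>

lemma proj_gen_mult:
  assumes "Y \<in> proj_gen R1 R2" "X \<in> proj_gen R1 R2"
  shows "X ** Y \<in> proj_gen R1 R2"
  using assms
proof (induction Y rule: proj_gen.induct)
  case (scal c)
  show ?case
    using scal(2,1)
  proof (induction X rule: proj_gen.induct)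
    case (scal d)
    then show ?case by (simp add: mat_mult_mat proj_gen.scal)
  qed (metis mat_mult_commute matrix_mul_assoc proj_gen.intros)+
qed (auto simp: matrix_mul_assoc intro: proj_gen.intros)

lemma proj_gen_generators:
  "R1 \<in> proj_gen R1 R2" "R2 \<in> proj_gen R1 R2"
  "matrix_inv R1 \<in> proj_gen R1 R2" "matrix_inv R2 \<in> proj_gen R1 R2"
  using proj_gen.intros(2-)[OF proj_gen.scal[of 1 R1 R2]] by simp_all

lemma proj_gen_scale: "X \<in> proj_gen R1 R2 \<Longrightarrow> k \<noteq> 0 \<Longrightarrow> mat k ** X \<in> proj_gen R1 R2"
  by (intro proj_gen_mult proj_gen.scal)

lemma proj_gen_subset:
  assumes "R1 \<in> G" "R2 \<in> G" "matrix_inv R1 \<in> G" "matrix_inv R2 \<in> G"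
    and "\<And>c. c \<noteq> 0 \<Longrightarrow> mat c \<in> G" "\<And>X Y. X \<in> G \<Longrightarrow> Y \<in> G \<Longrightarrow> X ** Y \<in> G"
  shows "proj_gen R1 R2 \<subseteq> G"
proof
  fix X assume "X \<in> proj_gen R1 R2"
  then show "X \<in> G" by induction (use assms in auto)
qed

subsection \<open>The ring generated by a complex number\<close>

lemma int_ring_gen_pCons:
  assumes "x \<in> int_ring_gen z"
  shows "of_int a + z * x \<in> int_ring_gen z"
proof -
  obtain p where "x = poly (map_poly of_int p) z"
    using assms unfolding int_ring_gen_def by blast
  then have "of_int a + z * x = poly (map_poly of_int (pCons a p)) z"
    by (simp add: map_poly_pCons)
  then show ?thesis unfolding int_ring_gen_def by blast
qed

lemma zero_in_int_ring_gen [simp]: "0 \<in> int_ring_gen z"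
  unfolding int_ring_gen_def by (auto intro!: exI[of _ 0])

text \<open>Horner's scheme as an induction rule. Products, complex conjugates and coordinates are
  handled with it.\<close>

lemma int_ring_gen_induct [consumes 1, case_names zero step]:
  assumes "x \<in> int_ring_gen z"
    and "P 0" and "\<And>a x. x \<in> int_ring_gen z \<Longrightarrow> P x \<Longrightarrow> P (of_int a + z * x)"
  shows "P x"
proof -
  obtain p where x: "x = poly (map_poly of_int p) z"
    using assms unfolding int_ring_gen_def by blast
  have "P (poly (map_poly of_int p) z)"
  proof (induction p)
    case (pCons a p)
    have "poly (map_poly of_int p) z \<in> int_ring_gen z"
      unfolding int_ring_gen_def by blast
    then show ?case
      using assms(3)[OF _ pCons.IH, of a] by (simp add: map_poly_pCons)
  qed (simp add: assms(2))
  then show ?thesis using x by simp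
qed

lemma of_int_in_int_ring_gen [simp]: "of_int a \<in> int_ring_gen z"
  using int_ring_gen_pCons[of 0 z a] by simp

lemma one_in_int_ring_gen [simp]: "1 \<in> int_ring_gen z"
  using of_int_in_int_ring_gen[of 1] by simp

lemma numeral_in_int_ring_gen [simp]: "numeral n \<in> int_ring_gen z"
  using of_int_in_int_ring_gen[of "numeral n"] by simp

lemma gen_in_int_ring_gen [simp]: "z \<in> int_ring_gen z"
  using int_ring_gen_pCons[of 1 z 0] by simp

lemma int_ring_gen_add:
  assumes "x \<in> int_ring_gen z" "y \<in> int_ring_gen z"
  shows "x + y \<in> int_ring_gen z"
proof -
  obtain p q where "x = poly (map_poly of_int p) z" "y = poly (map_poly of_int q) z"
    using assms unfolding int_ring_gen_def by blast
  moreover have "map_poly of_int (p + q) = map_poly of_int p + (map_poly of_int q :: complex poly)"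
    by (rule poly_eqI) (simp add: coeff_map_poly)
  ultimately have "x + y = poly (map_poly of_int (p + q)) z"
    by simp
  then show ?thesis unfolding int_ring_gen_def by blast
qed

lemma int_ring_gen_mult:
  assumes "x \<in> int_ring_gen z" "y \<in> int_ring_gen z"
  shows "x * y \<in> int_ring_gen z"
proof -
  have smult: "of_int a * y \<in> int_ring_gen z" for a
    using assms(2)
  proof (induction y rule: int_ring_gen_induct)
    case (step b y)
    then show ?case
      using int_ring_gen_pCons[of "of_int a * y" z "a * b"] by (simp add: algebra_simps)
  qed simp
  show ?thesis
    using assms(1)
  proof (induction x rule: int_ring_gen_induct)
    case (step a x)
    have "(of_int a + z * x) * y = of_int a * y + (of_int 0 + z * (x * y))"
      by (simp add: algebra_simps)
    then show ?case
      using step smult by (metis int_ring_gen_add int_ring_gen_pCons)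
  qed simp
qed

lemma int_ring_gen_uminus: "x \<in> int_ring_gen z \<Longrightarrow> - x \<in> int_ring_gen z"
  using int_ring_gen_mult[OF of_int_in_int_ring_gen[of "-1"], of x] by simp

lemma int_ring_gen_diff: "x \<in> int_ring_gen z \<Longrightarrow> y \<in> int_ring_gen z \<Longrightarrow> x - y \<in> int_ring_gen z"
  using int_ring_gen_add[OF _ int_ring_gen_uminus] by fastforce

lemma int_ring_gen_power: "x \<in> int_ring_gen z \<Longrightarrow> x ^ n \<in> int_ring_gen z"
  by (induction n) (auto intro: int_ring_gen_mult)

lemmas int_ring_gen_intros =
  int_ring_gen_add int_ring_gen_diff int_ring_gen_mult int_ring_gen_uminus int_ring_gen_power

section \<open>Roots of unity and complex conjugation in the ring they generate\<close>

lemma zeta_cis: "zeta m = cis (2 * pi / m)"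
  by (simp add: zeta_def cis_conv_exp mult_ac)

lemma norm_zeta [simp]: "norm (zeta m) = 1"
  by (simp add: zeta_cis)

lemma of_real_norm_power2: "complex_of_real (norm z) ^ 2 = z * cnj z"
  using complex_norm_square[of z] by simp

lemma zeta_mult_cnj [simp]: "zeta m * cnj (zeta m) = 1"
  using complex_norm_square[of "zeta m"] by simp

lemma zeta_power_self: "m > 0 \<Longrightarrow> zeta m ^ m = 1"
  by (simp add: zeta_cis Complex.DeMoivre)

lemma cnj_zeta: "m > 0 \<Longrightarrow> cnj (zeta m) = zeta m ^ (m - 1)"
proof -
  assume "m > 0"
  then have "zeta m * zeta m ^ (m - 1) = zeta m * cnj (zeta m)"
    using zeta_power_self[of m] by (cases m) auto
  then show ?thesis
    by (metis mult_cancel_left norm_zeta norm_zero zero_neq_one)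
qed

lemma cnj_in_int_ring_gen:
  assumes "m > 0" "x \<in> int_ring_gen (zeta m)"
  shows "cnj x \<in> int_ring_gen (zeta m)"
  using assms(2)
proof (induction x rule: int_ring_gen_induct)
  case (step a x)
  then show ?case
    using assms(1) by (auto simp: cnj_zeta intro!: int_ring_gen_intros)
qed simp

subsection \<open>The unitary group\<close>

text \<open>Multiplying \<open>d\<close> by \<open>a * cnj a - w * c * cnj c = 1\<close> and
  applying an off-diagonal equation gives the determinant times \<open>cnj a\<close>;
  \<open>b\<close> follows from the same equation. So the first column and the determinant fix the
  matrix.\<close>

lemma Gamma_matrix:
  assumes "mat2 (-1) 0 0 w = transpose (mat2 a b c d) ** mat2 (-1) 0 0 w ** conj_mat (mat2 a b c d)"
    and w: "w = of_real v" "v > 0"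
  shows "norm a ^ 2 = 1 + v * norm c ^ 2" and "norm (a * d - b * c) = 1"
    and "d = (a * d - b * c) * cnj a" and "b = (a * d - b * c) * w * cnj c"
proof -
  have eqs: "a * cnj a - w * c * cnj c = 1" "a * cnj b = w * c * cnj d"
      "b * cnj a = w * d * cnj c" "w * d * cnj d - b * cnj b = w"
    using assms(1) by (auto simp: algebra_simps)
  have w0: "w \<noteq> 0" "cnj w = w" using w by auto
  have "complex_of_real (norm a ^ 2) = of_real (1 + v * norm c ^ 2)"
    using eqs(1) w by (simp add: of_real_norm_power2 algebra_simps)
  then show na: "norm a ^ 2 = 1 + v * norm c ^ 2"
    using of_real_eq_iff by blast
  have a0: "a \<noteq> 0"
    using na w(2) by (auto simp: add_nonneg_eq_0_iff)
  have "d = (a * cnj a - w * c * cnj c) * d"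
    using eqs by simp
  also have "\<dots> = (a * d - b * c) * cnj a"
    using eqs(3) by (simp add: algebra_simps)
  finally show d: "d = (a * d - b * c) * cnj a" .
  have "cnj a * b = w * cnj c * d"
    using eqs(3) by (simp add: mult_ac)
  also have "\<dots> = cnj a * ((a * d - b * c) * w * cnj c)"
    by (subst d) (simp add: mult_ac)
  finally show b: "b = (a * d - b * c) * w * cnj c"
    using a0 by simp
  define e where "e = a * d - b * c"
  have d': "e * cnj a = d" and b': "e * w * cnj c = b"
    using d b by (simp_all add: e_def)
  \<comment> \<open>Inserting the second column into the last equation leaves only the factor
    \<open>e * cnj e\<close>, which must therefore be 1.\<close>
  have "w = w * (e * cnj a) * cnj (e * cnj a) - (e * w * cnj c) * cnj (e * w * cnj c)"
    unfolding d' b' using eqs(4) by simp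
  also have "\<dots> = w * (e * cnj e) * (a * cnj a - w * c * cnj c)"
    using w0(2) by (simp add: algebra_simps)
  finally have "w = w * (e * cnj e) * (a * cnj a - w * c * cnj c)" .
  then have "e * cnj e = 1"
    using w0 eqs(1) by simp
  then have "norm e ^ 2 = 1"
    by (metis complex_norm_square of_real_eq_1_iff)
  then show "norm (a * d - b * c) = 1"
    using power2_eq_1_iff[of "norm e"] norm_ge_zero[of e] unfolding e_def by linarith
qed

text \<open>The determinant has absolute value 1, so its inverse is its complex conjugate and lies
  in the ring; hence so do the entries of the inverse matrix.\<close>

lemma GammaI:
  assumes m: "m > 0" and "a \<in> int_ring_gen (zeta m)" "c \<in> int_ring_gen (zeta m)"
    "b \<in> int_ring_gen (zeta m)" "d \<in> int_ring_gen (zeta m)"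
    and w: "w = of_real v" "v > 0"
    and eq: "mat2 (-1) 0 0 w = transpose (mat2 a b c d) ** mat2 (-1) 0 0 w ** conj_mat (mat2 a b c d)"
  shows "mat2 a b c d \<in> Gamma m w"
proof -
  define e where "e = a * d - b * c"
  have ne: "norm e = 1"
    using Gamma_matrix(2)[OF eq w] by (simp add: e_def)
  then have "e * cnj e = 1"
    by (simp add: complex_norm_square [symmetric])
  then have inv: "inverse e = cnj e"
    by (simp add: inverse_unique)
  have e: "e \<in> int_ring_gen (zeta m)"
    unfolding e_def using assms by (auto intro!: int_ring_gen_intros)
  have *: "invertible (mat2 a b c d)"
    "matrix_inv (mat2 a b c d) = mat2 (cnj e * d) (- cnj e * b) (- cnj e * c) (cnj e * a)"
    using matrix_inv_mat2[of a d b c] ne inv unfolding e_def by fastforce+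
  have "- (cnj e * b) \<in> int_ring_gen (zeta m)" "- (cnj e * c) \<in> int_ring_gen (zeta m)"
    "cnj e * d \<in> int_ring_gen (zeta m)" "cnj e * a \<in> int_ring_gen (zeta m)"
    using assms e by (auto intro!: int_ring_gen_intros cnj_in_int_ring_gen)
  then have "mat2 a b c d \<in> GL2 (int_ring_gen (zeta m))"
    unfolding GL2_def using assms(2-5) * by (simp add: forall_2)
  then show ?thesis
    unfolding Gamma_def using eq by blast
qed

lemma Gamma_entries:
  assumes "mat2 a b c d \<in> Gamma m w"
  shows "a \<in> int_ring_gen (zeta m)" "b \<in> int_ring_gen (zeta m)"
    "c \<in> int_ring_gen (zeta m)" "d \<in> int_ring_gen (zeta m)"
    "mat2 (-1) 0 0 w = transpose (mat2 a b c d) ** mat2 (-1) 0 0 w ** conj_mat (mat2 a b c d)"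
proof -
  have "\<forall>i j. mat2 a b c d $ i $ j \<in> int_ring_gen (zeta m)"
    using assms by (auto simp: Gamma_def GL2_def)
  then show "a \<in> int_ring_gen (zeta m)" "b \<in> int_ring_gen (zeta m)"
      "c \<in> int_ring_gen (zeta m)" "d \<in> int_ring_gen (zeta m)"
    by (simp_all add: forall_2)
  show "mat2 (-1) 0 0 w = transpose (mat2 a b c d) ** mat2 (-1) 0 0 w ** conj_mat (mat2 a b c d)"
    using assms unfolding Gamma_def by blast
qed

lemma Gamma_mult:
  assumes "A \<in> Gamma m w" "B \<in> Gamma m w"
  shows "A ** B \<in> Gamma m w"
proof -
  let ?H = "mat2 (-1) 0 0 w"
  have inv: "invertible A" "invertible B"
    using assms by (auto simp: Gamma_def GL2_def)
  have "transpose (A ** B) ** ?H ** conj_mat (A ** B)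
      = transpose B ** (transpose A ** ?H ** conj_mat A) ** conj_mat B"
    by (simp add: matrix_transpose_mul conj_mat_mult matrix_mul_assoc)
  also have "\<dots> = ?H"
    using assms by (simp add: Gamma_def)
  finally have "?H = transpose (A ** B) ** ?H ** conj_mat (A ** B)" ..
  moreover have "(A ** B) $ i $ j \<in> int_ring_gen (zeta m)"
      "matrix_inv (A ** B) $ i $ j \<in> int_ring_gen (zeta m)" for i j
    using assms unfolding matrix_inv_mult[OF inv]
    by (auto simp: Gamma_def GL2_def matrix_matrix_mult_def sum_2 intro!: int_ring_gen_intros)
  ultimately show ?thesis
    using inv by (auto simp: Gamma_def GL2_def invertible_mult)
qed

lemma Gamma_inverse:
  assumes "A \<in> Gamma m w"
  shows "matrix_inv A \<in> Gamma m w"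
proof -
  let ?H = "mat2 (-1) 0 0 w" and ?B = "matrix_inv A"
  have inv: "invertible A" and eq: "?H = transpose A ** ?H ** conj_mat A"
    using assms by (auto simp: Gamma_def GL2_def)
  have AB: "A ** ?B = mat 1"
    using matrix_inv_cancel(1)[OF inv] .
  have "transpose ?B ** ?H ** conj_mat ?B
      = transpose ?B ** (transpose A ** ?H ** conj_mat A) ** conj_mat ?B"
    using eq by simp
  also have "\<dots> = transpose (A ** ?B) ** ?H ** conj_mat (A ** ?B)"
    by (simp add: matrix_transpose_mul conj_mat_mult matrix_mul_assoc)
  also have "\<dots> = ?H"
    unfolding AB by (simp add: mat_eq_mat2)
  finally show ?thesis
    using assms inv by (simp add: Gamma_def GL2_def invertible_matrix_inv)
qed

subsection \<open>Conjugates of real cyclotomic integers\<close>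

text \<open>Polynomial functions with integer coefficients. With \<open>p = 2 cos (2 pi / m)\<close> a real
  cyclotomic integer is written as \<open>f p\<close>, and its conjugates are the values of \<open>f\<close> at the conjugates of \<open>p\<close>.\<close>
inductive int_fun :: "(real \<Rightarrow> real) \<Rightarrow> bool" where
  const: "int_fun (\<lambda>_. of_int n)"
| ident: "int_fun (\<lambda>x. x)"
| add: "int_fun f \<Longrightarrow> int_fun g \<Longrightarrow> int_fun (\<lambda>x. f x + g x)"
| mult: "int_fun f \<Longrightarrow> int_fun g \<Longrightarrow> int_fun (\<lambda>x. f x * g x)"

lemma int_fun_numeral: "int_fun (\<lambda>_. numeral n)"
  using int_fun.const[of "numeral n"] by simp

lemma int_fun_one: "int_fun (\<lambda>_. 1)"
  using int_fun.const[of 1] by simp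

lemma int_fun_of_nat: "int_fun (\<lambda>_. of_nat n)"
  using int_fun.const[of "int n"] by simp

lemma int_fun_diff:
  assumes "int_fun f" "int_fun g"
  shows "int_fun (\<lambda>x. f x - g x)"
  using int_fun.add[OF assms(1) int_fun.mult[OF int_fun.const[of "-1"] assms(2)]] by simp

lemma int_fun_power: "int_fun f \<Longrightarrow> int_fun (\<lambda>x. f x ^ n)"
  by (induction n) (auto intro: int_fun_one int_fun.mult)

lemmas int_fun_intros =
  int_fun.intros int_fun_numeral int_fun_one int_fun_of_nat int_fun_diff int_fun_power

text \<open>The coefficients \<open>A\<close>, \<open>B\<close> are chosen before \<open>x\<close>:
  one reduction modulo the quadratic serves both roots, which ties the value at \<open>p\<close> to
  the value at its conjugate.\<close>

lemma int_fun_quadratic: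
  assumes "int_fun f"
  shows "\<exists>A B :: int. \<forall>x. x\<^sup>2 = of_int \<alpha> * x + of_int \<beta> \<longrightarrow> f x = of_int A + of_int B * x"
  using assms
proof induction
  case (const n)
  show ?case by (intro exI[of _ n] exI[of _ 0]) simp
next
  case ident
  show ?case by (intro exI[of _ 0] exI[of _ 1]) simp
next
  case (add f g)
  then obtain A B A' B' where
    "\<forall>x. x\<^sup>2 = of_int \<alpha> * x + of_int \<beta> \<longrightarrow> f x = of_int A + of_int B * x"
    "\<forall>x. x\<^sup>2 = of_int \<alpha> * x + of_int \<beta> \<longrightarrow> g x = of_int A' + of_int B' * x"
    by blast
  then show ?case
    by (intro exI[of _ "A + A'"] exI[of _ "B + B'"]) (simp add: algebra_simps)
next
  case (mult f g)
  then obtain A B A' B' where *: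
    "\<And>x. x\<^sup>2 = of_int \<alpha> * x + of_int \<beta> \<Longrightarrow> f x = of_int A + of_int B * x"
    "\<And>x. x\<^sup>2 = of_int \<alpha> * x + of_int \<beta> \<Longrightarrow> g x = of_int A' + of_int B' * x"
    by blast
  have "f x * g x = of_int (A * A' + B * B' * \<beta>) + of_int (A * B' + B * A' + B * B' * \<alpha>) * x"
    if "x\<^sup>2 = of_int \<alpha> * x + of_int \<beta>" for x
  proof -
    have "f x * g x = A * A' + (A * B' + B * A') * x + B * B' * x\<^sup>2"
      using *[OF that] by (simp add: algebra_simps power2_eq_square)
    then show ?thesis
      unfolding that by (simp add: algebra_simps)
  qed
  then show ?case by blast
qed

lemma int_fun_cubic:
  assumes "int_fun f"
  shows "\<exists>A B C :: int. \<forall>x. x ^ 3 = of_int \<alpha> * x\<^sup>2 + of_int \<beta> * x + of_int \<gamma> \<longrightarrow>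
           f x = of_int A + of_int B * x + of_int C * x\<^sup>2"
  using assms
proof induction
  case (const n)
  show ?case by (intro exI[of _ n] exI[of _ 0]) simp
next
  case ident
  show ?case by (rule exI[of _ 0], rule exI[of _ 1], rule exI[of _ 0]) simp
next
  case (add f g)
  then obtain A B C A' B' C' where
    "\<forall>x. x ^ 3 = of_int \<alpha> * x\<^sup>2 + of_int \<beta> * x + of_int \<gamma> \<longrightarrow> f x = of_int A + of_int B * x + of_int C * x\<^sup>2"
    "\<forall>x. x ^ 3 = of_int \<alpha> * x\<^sup>2 + of_int \<beta> * x + of_int \<gamma> \<longrightarrow> g x = of_int A' + of_int B' * x + of_int C' * x\<^sup>2"
    by blast
  then show ?case
    by (intro exI[of _ "A + A'"] exI[of _ "B + B'"] exI[of _ "C + C'"]) (simp add: algebra_simps)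
next
  case (mult f g)
  then obtain A B C A' B' C' where *:
    "\<And>x. x ^ 3 = of_int \<alpha> * x\<^sup>2 + of_int \<beta> * x + of_int \<gamma> \<Longrightarrow> f x = of_int A + of_int B * x + of_int C * x\<^sup>2"
    "\<And>x. x ^ 3 = of_int \<alpha> * x\<^sup>2 + of_int \<beta> * x + of_int \<gamma> \<Longrightarrow> g x = of_int A' + of_int B' * x + of_int C' * x\<^sup>2"
    by blast
  \<comment> \<open>The coefficient of \<open>x ^ 3\<close> once \<open>x ^ 4\<close> has been
    reduced to lower powers.\<close>
  define E where "E = B * C' + C * B' + C * C' * \<alpha>"
  have "f x * g x = of_int (A * A' + E * \<gamma>) + of_int (A * B' + B * A' + E * \<beta> + C * C' * \<gamma>) * x
      + of_int (A * C' + B * B' + C * A' + E * \<alpha> + C * C' * \<beta>) * x\<^sup>2"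
    if x: "x ^ 3 = of_int \<alpha> * x\<^sup>2 + of_int \<beta> * x + of_int \<gamma>" for x
  proof -
    have "x ^ 4 = x ^ 3 * x" by (simp add: eval_nat_numeral)
    also have "\<dots> = \<alpha> * x ^ 3 + \<beta> * x\<^sup>2 + \<gamma> * x"
      by (subst x) (simp add: algebra_simps eval_nat_numeral)
    finally have x4: "x ^ 4 = \<alpha> * x ^ 3 + \<beta> * x\<^sup>2 + \<gamma> * x" .
    have "f x * g x = A * A' + (A * B' + B * A') * x + (A * C' + B * B' + C * A') * x\<^sup>2
        + (B * C' + C * B') * x ^ 3 + C * C' * x ^ 4"
      using *[OF that] by (simp add: algebra_simps eval_nat_numeral)
    also have "\<dots> = A * A' + (A * B' + B * A') * x + (A * C' + B * B' + C * A') * x\<^sup>2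
        + E * x ^ 3 + C * C' * (\<beta> * x\<^sup>2 + \<gamma> * x)"
      unfolding x4 by (simp add: E_def algebra_simps)
    also have "\<dots> = of_int (A * A' + E * \<gamma>) + of_int (A * B' + B * A' + E * \<beta> + C * C' * \<gamma>) * x
      + of_int (A * C' + B * B' + C * A' + E * \<alpha> + C * C' * \<beta>) * x\<^sup>2"
      unfolding x by (simp add: algebra_simps)
    finally show ?thesis .
  qed
  then show ?case by blast
qed

section \<open>Coordinates with respect to 1 and \<open>zeta m\<close> over the real subring\<close>

lemma zeta_square: "zeta m ^ 2 = of_real (2 * cos (2 * pi / m)) * zeta m - 1"
proof -
  have "zeta m + cnj (zeta m) = of_real (2 * cos (2 * pi / m))"
    by (simp add: zeta_cis complex_eq_iff)
  then have "(zeta m + cnj (zeta m)) * zeta m = of_real (2 * cos (2 * pi / m)) * zeta m"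
    by simp
  then show ?thesis
    using zeta_mult_cnj[of m] by (simp add: algebra_simps power2_eq_square)
qed

text \<open>By \<open>zeta_square\<close>, multiplication by \<open>zeta m\<close> sends the
  coordinates \<open>(f, g)\<close> to \<open>(- g, f + p * g)\<close>. They are kept as polynomial
  functions, so that they can later be evaluated at the conjugates of \<open>p\<close>.\<close>

lemma int_ring_gen_zeta_coords:
  assumes "x \<in> int_ring_gen (zeta m)"
  shows "\<exists>f g. int_fun f \<and> int_fun g \<and>
    x = of_real (f (2 * cos (2 * pi / m))) + of_real (g (2 * cos (2 * pi / m))) * zeta m"
  using assms
proof (induction x rule: int_ring_gen_induct)
  case zero
  show ?case by (intro exI[of _ "\<lambda>_. of_int 0"]) (simp add: int_fun.const[of 0, simplified])
next
  case (step a x)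
  let ?p = "2 * cos (2 * pi / m)"
  obtain f g where fg: "int_fun f" "int_fun g" "x = of_real (f ?p) + of_real (g ?p) * zeta m"
    using step by blast
  have "of_int a + zeta m * x = of_int a + of_real (f ?p) * zeta m + of_real (g ?p) * zeta m ^ 2"
    by (simp add: fg(3) algebra_simps power2_eq_square)
  also have "\<dots> = of_real (of_int a - g ?p) + of_real (f ?p + ?p * g ?p) * zeta m"
    unfolding zeta_square by (simp add: algebra_simps)
  finally show ?case
    by (intro exI[of _ "\<lambda>x. of_int a - g x"] exI[of _ "\<lambda>x. f x + x * g x"])
       (auto intro!: int_fun_intros fg)
qed

text \<open>The form is the squared absolute value of \<open>f + g * u\<close> for a complex unit
  \<open>u\<close> with real part \<open>s / 2\<close>. It will represent the conjugates of
  \<open>norm x ^ 2\<close>.\<close>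

lemma binary_form_nonneg:
  fixes f g s :: real
  assumes "\<bar>s\<bar> < 2"
  shows "0 \<le> f\<^sup>2 + g\<^sup>2 + f * g * s"
proof -
  have "\<bar>f * g * s\<bar> \<le> \<bar>f * g\<bar> * 2"
    using assms by (simp add: abs_mult mult_left_mono)
  moreover have "2 * \<bar>f * g\<bar> \<le> f\<^sup>2 + g\<^sup>2"
    using sum_squares_bound[of "\<bar>f\<bar>" "\<bar>g\<bar>"] by (simp add: abs_mult)
  ultimately show ?thesis by linarith
qed

lemma norm_zeta_coords:
  fixes f g :: real
  shows "norm (of_real f + of_real g * zeta m) ^ 2 = f\<^sup>2 + g\<^sup>2 + f * g * (2 * cos (2 * pi / m))"
proof -
  have "norm (of_real f + of_real g * zeta m) ^ 2
      = (f + g * cos (2 * pi / m))\<^sup>2 + (g * sin (2 * pi / m))\<^sup>2"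
    by (simp add: cmod_power2 zeta_cis)
  also have "\<dots> = f\<^sup>2 + g\<^sup>2 * (sin (2 * pi / m) ^ 2 + cos (2 * pi / m) ^ 2) + f * g * (2 * cos (2 * pi / m))"
    by algebra
  finally show ?thesis by simp
qed

text \<open>The numbers \<open>z * zeta m ^ k\<close> point in directions spaced by 2 pi / m, so one
  of them lies within pi / m of the positive real axis.\<close>

lemma exists_zeta_power_near_real_axis:
  assumes "m > 0"
  shows "\<exists>k<m. Re (z * zeta m ^ k) \<ge> norm z * cos (pi / m)"
proof -
  define \<theta> where "\<theta> = Arg z"
  \<comment> \<open>The best integral exponent; reducing it modulo \<open>m\<close> brings it into
    the required range.\<close>
  define n where "n = round (- \<theta> * m / (2 * pi))"
  define k where "k = nat (n mod int m)"
  have k: "int k = n - int m * (n div int m)" "k < m"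
    using assms by (auto simp: k_def minus_mult_div_eq_mod nat_less_iff)
  have "zeta m ^ k = cis (2 * pi * real k / m)"
    by (simp add: zeta_cis Complex.DeMoivre mult_ac)
  also have "real k = real_of_int n - real m * real_of_int (n div int m)"
    using k(1) by (metis of_int_diff of_int_mult of_int_of_nat_eq)
  also have "2 * pi * (real_of_int n - real m * real_of_int (n div int m)) / m
      = 2 * pi * n / m - 2 * pi * of_int (n div int m)"
    using assms by (simp add: field_simps)
  also have "cis \<dots> = cis (2 * pi * n / m)"
    by (simp flip: cis_divide)
  finally have zk: "zeta m ^ k = cis (2 * pi * n / m)" .
  have "z = norm z * cis \<theta>"
    by (cases "z = 0") (simp_all add: \<theta>_def cis_Arg sgn_eq)
  then have "z * zeta m ^ k = norm z * cis (\<theta> + 2 * pi * n / m)"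
    by (metis zk cis_mult mult.assoc)
  then have Re: "Re (z * zeta m ^ k) = norm z * cos (\<theta> + 2 * pi * n / m)"
    by simp
  have "\<bar>real_of_int n - (- \<theta> * m / (2 * pi))\<bar> \<le> 1 / 2"
    unfolding n_def by (rule of_int_round_abs_le)
  then have "\<bar>real_of_int n + \<theta> * m / (2 * pi)\<bar> * (2 * pi / m) \<le> 1 / 2 * (2 * pi / m)"
    by (intro mult_right_mono) auto
  moreover have "\<bar>real_of_int n + \<theta> * m / (2 * pi)\<bar> * (2 * pi / m) = \<bar>\<theta> + 2 * pi * n / m\<bar>"
  proof -
    have "\<bar>real_of_int n + \<theta> * m / (2 * pi)\<bar> * (2 * pi / m)
        = \<bar>(real_of_int n + \<theta> * m / (2 * pi)) * (2 * pi / m)\<bar>"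
      by (simp add: abs_mult)
    also have "(real_of_int n + \<theta> * m / (2 * pi)) * (2 * pi / m) = \<theta> + 2 * pi * n / m"
      using assms by (simp add: field_simps)
    finally show ?thesis .
  qed
  ultimately have le: "\<bar>\<theta> + 2 * pi * n / m\<bar> \<le> pi / m" by simp
  moreover have "pi / m \<le> pi" using assms by (simp add: field_simps)
  ultimately have "cos (pi / m) \<le> cos \<bar>\<theta> + 2 * pi * n / m\<bar>"
    by (intro cos_monotone_0_pi_le) auto
  then have "cos (pi / m) \<le> cos (\<theta> + 2 * pi * n / m)" by simp
  then show ?thesis
    using k(2) Re by (auto intro!: exI[of _ k] mult_left_mono)
qed

text \<open>\<open>Q\<close> consists of the conjugates of \<open>p\<close> other than \<open>p\<close> itself.\<close>
locale cyclotomic_conjugates =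
  fixes m :: nat and p :: real and Q :: "real set"
  assumes m_ge_3: "m \<ge> 3"
    and p_def: "p = 2 * cos (2 * pi / m)"
    and conjugate_bound: "s \<in> Q \<Longrightarrow> \<bar>s\<bar> < 2"
    and conjugate_vanish: "int_fun f \<Longrightarrow> f p = 0 \<Longrightarrow> s \<in> Q \<Longrightarrow> f s = 0"
    and norm_ge_1: "int_fun f \<Longrightarrow> f p \<noteq> 0 \<Longrightarrow> 1 \<le> \<bar>f p\<bar> * (\<Prod>s\<in>Q. \<bar>f s\<bar>)"
    and unit_gap: "(2 - 2 * cos (pi / m)) * 4 ^ card Q < 1"
begin

abbreviation O\<^sub>K where "O\<^sub>K \<equiv> int_ring_gen (zeta m)"

lemma m_pos: "m > 0" using m_ge_3 by simp

lemma coords: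
  assumes "x \<in> O\<^sub>K"
  obtains f g where "int_fun f" "int_fun g" "x = of_real (f p) + of_real (g p) * zeta m"
  using int_ring_gen_zeta_coords[OF assms] unfolding p_def by blast

lemma conjugate_eq:
  assumes "int_fun f" "int_fun g" "f p = g p" "s \<in> Q"
  shows "f s = g s"
  using conjugate_vanish[OF int_fun_diff[OF assms(1,2)]] assms by simp

lemma norm_square_conjugates:
  assumes "x \<in> O\<^sub>K"
  obtains h where "int_fun h" "h p = norm x ^ 2" "\<And>s. s \<in> Q \<Longrightarrow> 0 \<le> h s"
proof -
  obtain f g where fg: "int_fun f" "int_fun g" "x = of_real (f p) + of_real (g p) * zeta m"
    using coords[OF assms] .
  show ?thesis
  proof
    show "int_fun (\<lambda>s. f s ^ 2 + g s ^ 2 + f s * g s * s)"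
      by (intro int_fun_intros fg(1,2))
    show "f p ^ 2 + g p ^ 2 + f p * g p * p = norm x ^ 2"
      unfolding fg(3) norm_zeta_coords by (simp add: p_def)
  qed (rule binary_form_nonneg, rule conjugate_bound)
qed

lemma ge_1_if_conjugates_le_1:
  assumes "int_fun f" "f p \<noteq> 0" "\<And>s. s \<in> Q \<Longrightarrow> \<bar>f s\<bar> \<le> 1"
  shows "1 \<le> \<bar>f p\<bar>"
proof -
  have "(\<Prod>s\<in>Q. \<bar>f s\<bar>) \<le> (\<Prod>s\<in>Q. 1)"
    using assms(3) by (intro prod_mono) auto
  then have "\<bar>f p\<bar> * (\<Prod>s\<in>Q. \<bar>f s\<bar>) \<le> \<bar>f p\<bar> * 1"
    by (intro mult_left_mono) auto
  then show ?thesis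
    using norm_ge_1[OF assms(1,2)] by linarith
qed

text \<open>All conjugates of such a \<open>u\<close> lie on the unit circle, so once \<open>u\<close> is turned
  into the sector around \<open>1\<close> the norm of \<open>u - 1\<close> is too small to be nonzero.\<close>
lemma unit_eq_zeta_power:
  assumes "u \<in> O\<^sub>K" "norm u = 1"
  obtains k where "u = zeta m ^ k"
proof -
  obtain k where k: "k < m" "Re (u * zeta m ^ k) \<ge> cos (pi / m)"
    using exists_zeta_power_near_real_axis[OF m_pos, of u] assms(2) by auto
  define x where "x = u * zeta m ^ k"
  have "x \<in> O\<^sub>K"
    unfolding x_def using assms by (intro int_ring_gen_intros) auto
  then obtain f g where fg: "int_fun f" "int_fun g" "x = of_real (f p) + of_real (g p) * zeta m"
    using coords by blast
  have nx: "norm x = 1"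
    by (simp add: x_def norm_mult norm_power assms)
  have h_p: "f p ^ 2 + g p ^ 2 + f p * g p * p = 1"
    using norm_zeta_coords[of "f p" "g p" m] nx unfolding fg(3)[symmetric] by (simp add: p_def)
  have h_s: "f s ^ 2 + g s ^ 2 + f s * g s * s = 1" if "s \<in> Q" for s
    using conjugate_eq[of "\<lambda>s. f s ^ 2 + g s ^ 2 + f s * g s * s" "\<lambda>_. 1"] h_p that
    by (simp add: int_fun_intros fg)
  \<comment> \<open>At \<open>p\<close> this is \<open>norm (x - 1) ^ 2\<close>, because
    \<open>norm x = 1\<close>; elsewhere it is the corresponding conjugate.\<close>
  define k' where "k' s = 2 - (2 * f s + g s * s)" for s
  have k': "int_fun k'"
    unfolding k'_def by (intro int_fun_intros fg(1,2))
  have k'_p: "k' p = 2 - 2 * Re x"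
    unfolding k'_def fg(3) by (simp add: p_def zeta_cis)
  \<comment> \<open>The conjugates of \<open>norm (x - 1) ^ 2\<close> and
    \<open>norm (x + 1) ^ 2\<close> are nonnegative and add up to 4.\<close>
  have k'_s: "0 \<le> k' s" "k' s \<le> 4" if "s \<in> Q" for s
    using binary_form_nonneg[OF conjugate_bound[OF that], of "f s - 1" "g s"]
      binary_form_nonneg[OF conjugate_bound[OF that], of "f s + 1" "g s"] h_s[OF that]
    by (simp_all add: k'_def power2_eq_square algebra_simps)
  have "\<bar>k' p\<bar> \<le> 2 - 2 * cos (pi / m)"
    using k(2) abs_Re_le_cmod[of x] nx unfolding k'_p x_def by linarith
  moreover have "(\<Prod>s\<in>Q. \<bar>k' s\<bar>) \<le> (\<Prod>s\<in>Q. 4)"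
    using k'_s by (intro prod_mono) auto
  ultimately have "\<bar>k' p\<bar> * (\<Prod>s\<in>Q. \<bar>k' s\<bar>) \<le> (2 - 2 * cos (pi / m)) * 4 ^ card Q"
    by (intro mult_mono) (auto intro: prod_nonneg)
  then have "k' p = 0"
    using norm_ge_1[OF k'] unit_gap by force
  then have "Re x = 1"
    using k'_p by simp
  moreover from this have "Im x = 0"
    using nx by (simp add: cmod_def)
  ultimately have "u * zeta m ^ k = 1"
    by (simp add: x_def complex_eq_iff)
  moreover have "zeta m ^ k * zeta m ^ (m - k) = 1"
    using k(1) zeta_power_self[OF m_pos] by (simp flip: power_add)
  ultimately have "u = zeta m ^ (m - k)"
    by (metis mult.assoc mult.commute mult.right_neutral)
  then show ?thesis by (rule that)
qed

end

text \<open>\<open>W s / N\<close> is the conjugate of the form parameter \<open>v = W p / N\<close>; the denominator is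
  needed because \<open>v\<close> need not be an algebraic integer.\<close>
locale lorentz_lattice = cyclotomic_conjugates +
  fixes v :: real and W :: "real \<Rightarrow> real" and N :: nat
  assumes v_pos: "v > 0" and N_pos: "N > 0"
    and W: "int_fun W" "W p = real N * v"
    and W_neg: "s \<in> Q \<Longrightarrow> W s < 0"
begin

text \<open>Clearing the denominator \<open>N\<close> turns the column equation into an equation
  between integral polynomial functions at \<open>p\<close>, which passes to the conjugates. There
  \<open>W s\<close> is negative, which forces \<open>h s\<close> to be at most 1.\<close>

lemma column_conjugates:
  assumes "a \<in> O\<^sub>K" "c \<in> O\<^sub>K" "norm a ^ 2 = 1 + v * norm c ^ 2"
  obtains h k where "int_fun h" "int_fun k" "h p = norm a ^ 2" "k p = norm c ^ 2"
    "\<forall>s\<in>Q. 0 \<le> h s \<and> h s \<le> 1 \<and> 0 \<le> k s \<and> real N * (h s - 1) = W s * k s"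
proof -
  obtain h where h: "int_fun h" "h p = norm a ^ 2" "\<And>s. s \<in> Q \<Longrightarrow> 0 \<le> h s"
    using norm_square_conjugates[OF assms(1)] by blast
  obtain k where k: "int_fun k" "k p = norm c ^ 2" "\<And>s. s \<in> Q \<Longrightarrow> 0 \<le> k s"
    using norm_square_conjugates[OF assms(2)] by blast
  have eq: "real N * (h s - 1) = W s * k s" if "s \<in> Q" for s
  proof (rule conjugate_eq[of "\<lambda>s. real N * (h s - 1)" "\<lambda>s. W s * k s", OF _ _ _ that])
    show "int_fun (\<lambda>s. real N * (h s - 1))" "int_fun (\<lambda>s. W s * k s)"
      by (intro int_fun_intros h(1) k(1) W(1))+
    show "real N * (h p - 1) = W p * k p"
      by (simp add: h(2) k(2) W(2) assms(3))
  qed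
  have "h s \<le> 1" if "s \<in> Q" for s
  proof -
    have "W s * k s \<le> 0"
      using W_neg[OF that] k(3)[OF that] by (simp add: mult_nonpos_nonneg)
    then have "real N * (h s - 1) \<le> 0"
      using eq[OF that] by simp
    then show ?thesis
      using N_pos by (simp add: mult_le_0_iff)
  qed
  then show ?thesis
    using that[OF h(1) k(1) h(2) k(2)] h(3) k(3) eq by blast
qed

text \<open>All other conjugates of both values lie in [0, 1], so those of the difference have
  absolute value at most 1. This makes the descent terminate.\<close>

lemma norm_square_discrete:
  assumes "a \<in> O\<^sub>K" "c \<in> O\<^sub>K" "norm a ^ 2 = 1 + v * norm c ^ 2"
    and "a' \<in> O\<^sub>K" "c' \<in> O\<^sub>K" "norm a' ^ 2 = 1 + v * norm c' ^ 2"
    and "norm a' ^ 2 < norm a ^ 2"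
  shows "norm a' ^ 2 + 1 \<le> norm a ^ 2"
proof -
  obtain h k where h: "int_fun h" "int_fun k" "h p = norm a ^ 2" "k p = norm c ^ 2"
      "\<forall>s\<in>Q. 0 \<le> h s \<and> h s \<le> 1 \<and> 0 \<le> k s \<and> real N * (h s - 1) = W s * k s"
    by (rule column_conjugates[OF assms(1-3)])
  obtain h' k' where h': "int_fun h'" "int_fun k'" "h' p = norm a' ^ 2" "k' p = norm c' ^ 2"
      "\<forall>s\<in>Q. 0 \<le> h' s \<and> h' s \<le> 1 \<and> 0 \<le> k' s \<and> real N * (h' s - 1) = W s * k' s"
    by (rule column_conjugates[OF assms(4-6)])
  have "1 \<le> \<bar>h p - h' p\<bar>"
  proof (rule ge_1_if_conjugates_le_1)
    show "int_fun (\<lambda>x. h x - h' x)" by (intro int_fun_intros h(1) h'(1))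
    show "h p - h' p \<noteq> 0" using assms(7) unfolding h(3) h'(3) by linarith
    show "\<bar>h s - h' s\<bar> \<le> 1" if "s \<in> Q" for s
      using h(5)[rule_format, OF that] h'(5)[rule_format, OF that] by linarith
  qed
  then show ?thesis using assms(7) h h' by linarith
qed

text \<open>The product of the conjugates of \<open>t(1 + t)\<close>, where \<open>t = norm a ^ 2 - 1\<close>, is at least
  \<open>1\<close>, and each conjugate of \<open>t\<close> lies between \<open>-1\<close> and \<open>0\<close>.\<close>
lemma column_gap:
  assumes "a \<in> O\<^sub>K" "c \<in> O\<^sub>K" "norm a ^ 2 = 1 + v * norm c ^ 2" "c \<noteq> 0"
  shows "4 ^ card Q \<le> (norm a ^ 2 - 1) * norm a ^ 2"
proof -
  obtain h k where h: "int_fun h" "int_fun k" "h p = norm a ^ 2" "k p = norm c ^ 2"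
      "\<forall>s\<in>Q. 0 \<le> h s \<and> h s \<le> 1 \<and> 0 \<le> k s \<and> real N * (h s - 1) = W s * k s"
    by (rule column_conjugates[OF assms(1-3)])
  define g where "g s = (h s - 1) * h s" for s
  have g: "int_fun g"
    unfolding g_def by (intro int_fun_intros h(1))
  have "v * norm c ^ 2 > 0" using v_pos assms(4) by simp
  then have gp: "g p = (norm a ^ 2 - 1) * norm a ^ 2" "g p > 0"
    using assms(3) by (simp_all add: g_def h)
  have "\<bar>g s\<bar> \<le> 1 / 4" if "s \<in> Q" for s
  proof -
    have "(1 - h s) * h s \<le> 1 / 4"
      using zero_le_power2[of "h s - 1 / 2"] by (simp add: power2_eq_square algebra_simps)
    then show ?thesis
      using h(5)[rule_format, OF that] by (simp add: g_def abs_mult)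
  qed
  then have "(\<Prod>s\<in>Q. \<bar>g s\<bar>) \<le> (\<Prod>s\<in>Q. 1 / 4)"
    by (intro prod_mono) auto
  then have "g p * (\<Prod>s\<in>Q. \<bar>g s\<bar>) \<le> g p * (1 / 4) ^ card Q"
    using gp by (intro mult_left_mono) auto
  moreover have "1 \<le> g p * (\<Prod>s\<in>Q. \<bar>g s\<bar>)"
    using norm_ge_1[OF g] gp(2) by simp
  ultimately have "1 \<le> g p * (1 / 4) ^ card Q" by linarith
  then show ?thesis
    unfolding gp(1)[symmetric] by (simp add: power_divide field_simps)
qed

end

subsection \<open>Descent\<close>

text \<open>In the application \<open>t\<close> and \<open>t\<^sub>0\<close> are
  \<open>norm a ^ 2 - 1\<close> and \<open>norm a\<^sub>0 ^ 2 - 1\<close>, \<open>x\<close> and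
  \<open>y\<close> are the absolute values of the two summands of the new corner entry,
  \<open>C = cos (pi / m)\<close> and \<open>\<sigma> = sin (pi / q) ^ 2\<close>. The claim amounts
  to \<open>t\<^sub>0 * (1 + 2 * t) < 2 * (x * y * C)\<close>, which squaring reduces to
  \<open>gap\<close>.\<close>

lemma descent_inequality:
  fixes t t\<^sub>0 x y C \<sigma> :: real
  assumes "t > 0" "t\<^sub>0 > 0" "C \<ge> 0" "x \<ge> 0" "y \<ge> 0"
    and x: "x\<^sup>2 = (1 + t\<^sub>0) * (1 + t)" and y: "y\<^sup>2 = t\<^sub>0 * t"
    and C: "(1 + t\<^sub>0) * C\<^sup>2 = t\<^sub>0 + \<sigma>" and gap: "t\<^sub>0 < 4 * (t * (1 + t)) * \<sigma>"
  shows "x\<^sup>2 + y\<^sup>2 - 2 * (x * y * C) < 1 + t"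
proof -
  have "(t\<^sub>0 * (1 + 2 * t))\<^sup>2 = t\<^sub>0 * (t\<^sub>0 + 4 * (t * (1 + t)) * t\<^sub>0)"
    by (simp add: power2_eq_square algebra_simps)
  also have "\<dots> < t\<^sub>0 * (4 * (t * (1 + t)) * \<sigma> + 4 * (t * (1 + t)) * t\<^sub>0)"
    using assms(2) gap by (intro mult_strict_left_mono) auto
  also have "\<dots> = 4 * (t\<^sub>0 * t) * (1 + t) * (t\<^sub>0 + \<sigma>)"
    by (simp add: algebra_simps)
  also have "\<dots> = 4 * y\<^sup>2 * x\<^sup>2 * C\<^sup>2"
    unfolding C[symmetric] x y by (simp add: algebra_simps)
  also have "\<dots> = (2 * (x * y * C))\<^sup>2"
    by (simp add: power_mult_distrib)
  finally have "t\<^sub>0 * (1 + 2 * t) < 2 * (x * y * C)"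
    using assms by (intro power2_less_imp_less[of "t\<^sub>0 * (1 + 2 * t)"]) auto
  then show ?thesis
    using x y by (simp add: algebra_simps)
qed

lemma norm_add_square: "norm (x + y) ^ 2 = norm x ^ 2 + norm y ^ 2 + 2 * Re (x * cnj y)"
  for x y :: complex
  unfolding cmod_power2 by (simp add: power2_eq_square algebra_simps)

text \<open>The four entries of the unitarity equation for the matrix with rows
  \<open>(a, b)\<close> and \<open>(c, - a)\<close>, in the shape to which the matrix product
  unfolds. Primed letters stand for complex conjugates, which makes the identities purely
  algebraic.\<close>

lemma reflection_identities:
  fixes a a' b b' c c' k k' v :: complex
  assumes "k * k' = 1" "k' * a = a'" "k * a' = a" "a * a' = 1 + v * (c * c')"
    "b = - (k * v * c')" "b' = - (k' * v * c)"
  shows "- 1 = (a * - 1 + c * 0) * a' + (a * 0 + c * v) * c'"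
    "0 = (a * - 1 + c * 0) * b' + (a * 0 + c * v) * - a'"
    "0 = (b * - 1 + - a * 0) * a' + (b * 0 + - a * v) * c'"
    "v = (b * - 1 + - a * 0) * b' + (b * 0 + - a * v) * - a'"
  subgoal using assms(4) by (simp add: algebra_simps)
  subgoal using assms(2) unfolding assms(6) by (simp add: algebra_simps flip: assms(2))
  subgoal unfolding assms(5) by (simp add: algebra_simps flip: assms(3))
  subgoal
  proof -
    have "(b * - 1 + - a * 0) * b' + (b * 0 + - a * v) * - a'
        = v * (a * a') - (k * k') * (v * (v * (c * c')))"
      unfolding assms(5,6) by (simp add: algebra_simps)
    then show ?thesis
      unfolding assms(1,4) by (simp add: algebra_simps)
  qed
  done

text \<open>\<open>S\<close> is an elliptic element of order two and \<open>S D\<close>, with \<open>D = diag(zeta m, 1)\<close>, one of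
  order \<open>q\<close>: the prescribed value of \<open>norm a\<^sub>0\<close> says that \<open>trace\<^sup>2 / det\<close> of \<open>S D\<close> equals
  \<open>4 cos\<^sup>2 (pi / q)\<close>.\<close>
locale triangle_lattice = lorentz_lattice +
  fixes q :: nat and a\<^sub>0 c\<^sub>0 \<kappa> :: complex
  assumes q_ge_3: "q \<ge> 3" and hyperbolic: "pi / q + pi / m < pi / 2"
    and entries: "a\<^sub>0 \<in> O\<^sub>K" "c\<^sub>0 \<in> O\<^sub>K" "\<kappa> * of_real v * cnj c\<^sub>0 \<in> O\<^sub>K"
    and a0_phase: "\<kappa> * cnj a\<^sub>0 = a\<^sub>0"
    and a0_c0: "norm a\<^sub>0 ^ 2 = 1 + v * norm c\<^sub>0 ^ 2" "c\<^sub>0 \<noteq> 0"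
    and a0_norm: "norm a\<^sub>0 ^ 2 * sin (pi / m) ^ 2 = cos (pi / q) ^ 2"
    and gap: "\<lbrakk>a \<in> O\<^sub>K; c \<in> O\<^sub>K; norm a ^ 2 = 1 + v * norm c ^ 2; c \<noteq> 0\<rbrakk> \<Longrightarrow>
      norm a\<^sub>0 ^ 2 - 1 < 4 * ((norm a ^ 2 - 1) * norm a ^ 2) * sin (pi / q) ^ 2"
begin

text \<open>Trace zero makes \<open>S\<close> an involution up to scalars. Its determinant is
  \<open>- \<kappa>\<close>, so the second column is the one forced by \<open>Gamma_matrix\<close>;
  \<open>a0_phase\<close> turns its lower entry into \<open>- a\<^sub>0\<close>.\<close>

definition "S = mat2 a\<^sub>0 (- (\<kappa> * of_real v * cnj c\<^sub>0)) c\<^sub>0 (- a\<^sub>0)"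

definition "D = mat2 (zeta m) 0 0 1"

abbreviation "\<Gamma> \<equiv> Gamma m (of_real v)"

lemma a0_nonzero: "a\<^sub>0 \<noteq> 0"
  using a0_c0 v_pos by (auto simp: add_nonneg_eq_0_iff)

lemma norm_kappa: "norm \<kappa> = 1"
  using arg_cong[OF a0_phase, of norm] a0_nonzero by (simp add: norm_mult)

lemma kappa_nonzero: "\<kappa> \<noteq> 0"
  using norm_kappa by auto

lemma S_square: "S ** S = mat \<kappa>"
proof -
  have "a\<^sub>0 * a\<^sub>0 - \<kappa> * of_real v * cnj c\<^sub>0 * c\<^sub>0 = \<kappa> * (cnj a\<^sub>0 * a\<^sub>0 - of_real v * (cnj c\<^sub>0 * c\<^sub>0))"
    using a0_phase by (simp add: algebra_simps)
  also have "cnj a\<^sub>0 * a\<^sub>0 - of_real v * (cnj c\<^sub>0 * c\<^sub>0) = of_real (norm a\<^sub>0 ^ 2 - v * norm c\<^sub>0 ^ 2)"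
    by (simp add: of_real_norm_power2 mult.commute)
  finally show ?thesis
    using a0_c0 by (simp add: S_def mat_eq_mat2 algebra_simps)
qed

lemma S_in_Gamma: "S \<in> \<Gamma>"
proof -
  define b where "b = - (\<kappa> * of_real v * cnj c\<^sub>0)"
  have k: "\<kappa> * cnj \<kappa> = 1"
    using norm_kappa complex_norm_square[of \<kappa>] by simp
  have cnj: "cnj \<kappa> * a\<^sub>0 = cnj a\<^sub>0"
    using arg_cong[OF a0_phase, of cnj] by simp
  have n: "a\<^sub>0 * cnj a\<^sub>0 = 1 + of_real v * (c\<^sub>0 * cnj c\<^sub>0)"
    using arg_cong[OF a0_c0(1), of complex_of_real] by (simp add: of_real_norm_power2)
  have cb: "cnj b = - (cnj \<kappa> * of_real v * c\<^sub>0)"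
    by (simp add: b_def)
  have "mat2 a\<^sub>0 b c\<^sub>0 (- a\<^sub>0) \<in> \<Gamma>"
  proof (rule GammaI[OF m_pos _ _ _ _ refl v_pos])
    show "mat2 (- 1) 0 0 (of_real v) = transpose (mat2 a\<^sub>0 b c\<^sub>0 (- a\<^sub>0)) **
        mat2 (- 1) 0 0 (of_real v) ** conj_mat (mat2 a\<^sub>0 b c\<^sub>0 (- a\<^sub>0))"
      unfolding transpose_mat2 conj_mat_mat2 mat2_mult mat2_eq_iff complex_cnj_minus
      by (intro conjI reflection_identities[OF k cnj a0_phase n b_def cb])
  qed (use entries in \<open>auto simp: b_def intro!: int_ring_gen_intros\<close>)
  then show ?thesis
    by (simp add: S_def b_def)
qed

lemma diag_in_Gamma: "mat2 (zeta m ^ k) 0 0 1 \<in> \<Gamma>"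
proof (rule GammaI[OF m_pos _ _ _ _ refl v_pos])
  have "zeta m ^ k * cnj (zeta m ^ k) = 1"
    by (simp flip: power_mult_distrib)
  then show "mat2 (- 1) 0 0 (of_real v) =
    transpose (mat2 (zeta m ^ k) 0 0 1) ** mat2 (- 1) 0 0 (of_real v) ** conj_mat (mat2 (zeta m ^ k) 0 0 1)"
    by simp
qed (auto intro!: int_ring_gen_intros)

lemma descent_step:
  assumes A: "mat2 a b c d \<in> \<Gamma>" and "c \<noteq> 0"
  obtains k where "k < m" "norm ((S ** (mat2 (zeta m ^ k) 0 0 1 ** mat2 a b c d)) $ 1 $ 1) ^ 2 < norm a ^ 2"
proof -
  define b\<^sub>0 where "b\<^sub>0 = - (\<kappa> * of_real v * cnj c\<^sub>0)"
  define t where "t = v * norm c ^ 2"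
  define t\<^sub>0 where "t\<^sub>0 = v * norm c\<^sub>0 ^ 2"
  note AG = Gamma_entries[OF A]
  have na: "norm a ^ 2 = 1 + t"
    unfolding t_def by (rule Gamma_matrix(1)[OF AG(5) refl v_pos])
  have t: "t > 0" "t\<^sub>0 > 0"
    using v_pos assms(2) a0_c0(2) by (auto simp: t_def t\<^sub>0_def)
  \<comment> \<open>The cross term of the two summands of the new corner entry. Turning
    \<open>- z\<close> towards the positive axis makes the summands point in nearly opposite
    directions.\<close>
  define z where "z = a\<^sub>0 * a * cnj (b\<^sub>0 * c)"
  obtain k where k: "k < m" "Re (- z * zeta m ^ k) \<ge> norm (- z) * cos (pi / m)"
    using exists_zeta_power_near_real_axis[OF m_pos] by blast
  have "norm (a\<^sub>0 * zeta m ^ k * a + b\<^sub>0 * c) ^ 2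
      = norm (a\<^sub>0 * a) ^ 2 + norm (b\<^sub>0 * c) ^ 2 + 2 * Re (z * zeta m ^ k)"
    unfolding norm_add_square z_def by (simp add: norm_mult norm_power mult_ac)
  also have "\<dots> \<le> norm (a\<^sub>0 * a) ^ 2 + norm (b\<^sub>0 * c) ^ 2
      - 2 * (norm (a\<^sub>0 * a) * norm (b\<^sub>0 * c) * cos (pi / m))"
  proof -
    have "norm z * cos (pi / m) \<le> - Re (z * zeta m ^ k)"
      using k(2) by simp
    moreover have "norm z = norm (a\<^sub>0 * a) * norm (b\<^sub>0 * c)"
      by (simp add: z_def norm_mult)
    ultimately show ?thesis by simp
  qed
  also have "\<dots> < 1 + t"
  proof (rule descent_inequality[OF t, where \<sigma> = "sin (pi / q) ^ 2"])
    show "cos (pi / m) \<ge> 0"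
    proof (rule cos_ge_zero)
      show "pi / m \<le> pi / 2"
        using m_ge_3 by (simp add: field_simps)
      have "0 \<le> pi / m" by simp
      then show "- (pi / 2) \<le> pi / m"
        using pi_gt_zero by linarith
    qed
    show "norm (a\<^sub>0 * a) ^ 2 = (1 + t\<^sub>0) * (1 + t)"
      using na a0_c0 by (simp add: norm_mult power_mult_distrib t\<^sub>0_def)
    show "norm (b\<^sub>0 * c) ^ 2 = t\<^sub>0 * t"
      using v_pos by (simp add: norm_mult power_mult_distrib t\<^sub>0_def t_def b\<^sub>0_def norm_kappa power2_eq_square)
    \<comment> \<open>The condition on \<open>C\<close> in \<open>descent_inequality\<close> is
      \<open>a0_norm\<close> with sines and cosines exchanged.\<close>
    have "(1 + t\<^sub>0) * cos (pi / m) ^ 2 = norm a\<^sub>0 ^ 2 - norm a\<^sub>0 ^ 2 * sin (pi / m) ^ 2"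
      using a0_c0(1) by (simp add: t\<^sub>0_def cos_squared_eq algebra_simps)
    then show "(1 + t\<^sub>0) * cos (pi / m) ^ 2 = t\<^sub>0 + sin (pi / q) ^ 2"
      using a0_norm a0_c0(1) by (simp add: t\<^sub>0_def cos_squared_eq)
    show "t\<^sub>0 < 4 * (t * (1 + t)) * sin (pi / q) ^ 2"
      using gap[OF AG(1,3) _ assms(2)] na a0_c0(1) by (simp add: t_def t\<^sub>0_def)
  qed auto
  finally have "norm (a\<^sub>0 * zeta m ^ k * a + b\<^sub>0 * c) ^ 2 < norm a ^ 2"
    using na by simp
  then show ?thesis
    using that[OF k(1)] by (simp add: S_def b\<^sub>0_def mult_ac)
qed

lemma Gamma_generated:
  assumes S: "S \<in> G" and D: "D \<in> G"
    and scal: "\<And>k. k \<noteq> 0 \<Longrightarrow> mat k \<in> G"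
    and mult: "\<And>X Y. X \<in> G \<Longrightarrow> Y \<in> G \<Longrightarrow> X ** Y \<in> G"
  shows "\<Gamma> \<subseteq> G"
proof
  have D_power: "mat2 (zeta m ^ k) 0 0 1 \<in> G" for k
  proof (induction k)
    case 0
    then show ?case using scal[of 1] by (simp add: mat_eq_mat2)
  next
    case (Suc k)
    then show ?case using mult[OF D Suc] by (simp add: D_def)
  qed
  \<comment> \<open>Induction on an integer bound for the squared corner entry: by
    \<open>norm_square_discrete\<close> each descent step lowers the entry by at least 1.\<close>
  have "A \<in> G" if "A \<in> \<Gamma>" "norm (A $ 1 $ 1) ^ 2 < real n" for n A
    using that
  proof (induction n arbitrary: A)
    case 0
    then show ?case using zero_le_power2[of "norm (A $ 1 $ 1)"] by simp
  next
    case (Suc n)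
    obtain a b c d where A: "A = mat2 a b c d" by (rule mat2_cases)
    note AG = Gamma_entries[OF Suc.prems(1)[unfolded A]]
    note AG' = Gamma_matrix[OF AG(5) refl v_pos]
    show ?case
    proof (cases "c = 0")
      case True
      define e where "e = a * d - b * c"
      have "norm a ^ 2 = 1" using AG'(1) True by simp
      then have a: "norm a = 1" "a * cnj a = 1"
        using complex_norm_square[of a] norm_ge_zero[of a] by (auto simp: power2_eq_1_iff)
      have d: "d = e * cnj a" "b = 0" "norm e = 1"
        using AG' True unfolding e_def by auto
      then have "e * cnj e = 1"
        using complex_norm_square[of e] by simp
      have "e \<in> O\<^sub>K"
        unfolding e_def using AG by (auto intro!: int_ring_gen_intros)
      \<comment> \<open>As \<open>a\<close> and \<open>e\<close> have absolute value 1, the quotient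
        \<open>a / d\<close> equals \<open>cnj e * a ^ 2\<close>, a ring element of absolute value 1
        and hence a power of \<open>zeta m\<close>.\<close>
      then obtain k where k: "cnj e * a ^ 2 = zeta m ^ k"
        using AG(1) a d(3) m_pos
        by (elim unit_eq_zeta_power[of "cnj e * a ^ 2", rotated 2])
           (auto intro!: int_ring_gen_intros cnj_in_int_ring_gen simp: norm_mult norm_power)
      have "a = d * (cnj e * a ^ 2)"
      proof -
        have "d * (cnj e * a ^ 2) = (e * cnj e) * (a * cnj a) * a"
          by (simp add: d power2_eq_square mult_ac)
        then show ?thesis using a \<open>e * cnj e = 1\<close> by simp
      qed
      then have "A = mat d ** mat2 (zeta m ^ k) 0 0 1"
        by (simp add: A mat_eq_mat2 True d(2) flip: k)
      moreover have "d \<noteq> 0" using d a by auto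
      ultimately show ?thesis using mult scal D_power by metis
    next
      case False
      obtain k where k: "k < m"
        "norm ((S ** (mat2 (zeta m ^ k) 0 0 1 ** mat2 a b c d)) $ 1 $ 1) ^ 2 < norm a ^ 2"
        using descent_step[OF Suc.prems(1)[unfolded A] False] by blast
      define X where "X = S ** (mat2 (zeta m ^ k) 0 0 1 ** A)"
      have XG: "X \<in> \<Gamma>"
        unfolding X_def by (intro Gamma_mult S_in_Gamma diag_in_Gamma Suc.prems(1))
      obtain a' b' c' d' where X: "X = mat2 a' b' c' d'" by (rule mat2_cases)
      have "norm a' ^ 2 < norm a ^ 2"
        using k(2) X by (simp add: X_def A)
      then have "norm a' ^ 2 + 1 \<le> norm a ^ 2"
        using Gamma_entries[OF XG[unfolded X]] AG
        by (intro norm_square_discrete[of a c a' c'] Gamma_matrix(1)[OF _ refl v_pos])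
      then have "X \<in> G"
        using Suc.prems(2) by (intro Suc.IH XG) (simp add: A X)
      \<comment> \<open>The inverse of \<open>S\<close> times the \<open>k\<close>-th power of
        \<open>D\<close>, written so that its membership in \<open>G\<close> is visible.\<close>
      define E where "E = mat (inverse \<kappa>) ** (mat2 (zeta m ^ (m - k)) 0 0 1 ** S)"
      have "E \<in> G"
        unfolding E_def using kappa_nonzero by (intro mult scal D_power S) auto
      have "mat2 (zeta m ^ (m - k)) 0 0 1 ** mat2 (zeta m ^ k) 0 0 1 = mat 1"
        using k(1) zeta_power_self[OF m_pos] by (simp add: mat_eq_mat2 flip: power_add)
      moreover have "E ** X = mat (inverse \<kappa>) ** (mat2 (zeta m ^ (m - k)) 0 0 1 **
          (S ** S) ** (mat2 (zeta m ^ k) 0 0 1 ** A))"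
        by (simp add: E_def X_def matrix_mul_assoc)
      moreover have "mat2 (zeta m ^ (m - k)) 0 0 1 ** mat \<kappa> ** (mat2 (zeta m ^ k) 0 0 1 ** A)
          = mat \<kappa> ** (mat2 (zeta m ^ (m - k)) 0 0 1 ** mat2 (zeta m ^ k) 0 0 1 ** A)"
        by (simp only: mat_mult_commute[of \<kappa> "mat2 (zeta m ^ (m - k)) 0 0 1", symmetric] matrix_mul_assoc)
      ultimately have "E ** X = mat (inverse \<kappa>) ** (mat \<kappa> ** A)"
        by (simp only: S_square matrix_mul_lid)
      then have "E ** X = mat (inverse \<kappa>) ** mat \<kappa> ** A"
        by (simp only: matrix_mul_assoc)
      then have "A = E ** X"
        using kappa_nonzero by (simp add: mat_mult_mat)
      then show ?thesis
        using mult[OF \<open>E \<in> G\<close> \<open>X \<in> G\<close>] by simp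
    qed
  qed
  then show "A \<in> G" if "A \<in> \<Gamma>" for A
    using that reals_Archimedean2 by blast
qed

end

subsection \<open>Right-angled hyperbolic triangles\<close>

text \<open>\<open>x * cnj y\<close> is \<open>x / y\<close> times the positive number
  \<open>norm y ^ 2\<close>, so both have the same argument.\<close>

lemma Arg_divide_eqI:
  assumes "x * cnj y = of_real s * cis \<theta>" "s > 0" "-pi < \<theta>" "\<theta> \<le> pi"
  shows "Arg (x / y) = \<theta>"
proof -
  have y: "y \<noteq> 0"
    using assms(1,2) by auto
  have "x / y = of_real (s / norm y ^ 2) * cis \<theta>"
    unfolding complex_div_cnj[of x y] assms(1) by simp
  then show ?thesis
    using Arg_unique[of "s / norm y ^ 2" \<theta> "x / y"] y assms(2-) by (simp add: cis_conv_exp)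
qed

text \<open>The triangle has a right angle at \<open>r\<close>, the angle \<alpha> at
  \<open>\<rho> * cis \<beta>\<close> and \<beta> at 0. Here \<open>k\<close> is tanh of the leg on
  the real axis, whose cosh is \<open>cos \<alpha> / sin \<beta>\<close>. A point at Euclidean
  distance \<open>r\<close> from 0 has hyperbolic distance with tanh equal to
  \<open>2 * r / (1 + r\<^sup>2)\<close>, which is the first equation. The others say that tanh of
  the leg is \<open>cos \<beta>\<close> times tanh of the hypotenuse, and that cosh of the
  hypotenuse is cot \<alpha> cot \<beta>.\<close>

lemma right_triangle_parameters:
  fixes \<alpha> \<beta> k :: real
  assumes ang: "0 < \<alpha>" "0 < \<beta>" "\<alpha> + \<beta> < pi / 2"
    and k: "k > 0" "k\<^sup>2 * cos \<alpha> ^ 2 = cos \<alpha> ^ 2 - sin \<beta> ^ 2"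
  obtains r \<rho> where "0 < r" "r < 1" "0 < \<rho>" "\<rho> < 1"
    "2 * r = k * (1 + r\<^sup>2)" "2 * \<rho> * cos \<beta> = k * (1 + \<rho>\<^sup>2)"
    "(1 - \<rho>\<^sup>2) * cos \<alpha> * cos \<beta> = (1 + \<rho>\<^sup>2) * sin \<alpha> * sin \<beta>"
proof -
  have pos: "cos \<alpha> > 0" "cos \<beta> > 0" "sin \<alpha> > 0" "sin \<beta> > 0" "cos (\<alpha> + \<beta>) > 0" "cos (\<alpha> - \<beta>) > 0"
    using ang by (auto intro!: cos_gt_zero_pi sin_gt_zero)
  have "k\<^sup>2 * cos \<alpha> ^ 2 < 1 * cos \<alpha> ^ 2"
    using k(2) pos by simp
  then have k1: "k\<^sup>2 < 1"
    using pos by (simp add: mult_less_cancel_right_disj)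
  define c where "c = sqrt (1 - k\<^sup>2)"
  have c: "c\<^sup>2 = 1 - k\<^sup>2" "c > 0"
    using k1 by (auto simp: c_def)
  have "c < 1"
    using c k(1) by (intro power2_less_imp_less[of c 1]) auto
  have k_lt: "k < 1"
    using k1 k(1) by (intro power2_less_imp_less[of k 1]) auto
  \<comment> \<open>The root of \<open>k * r\<^sup>2 - 2 * r + k = 0\<close> inside the
    disc.\<close>
  define r where "r = (1 - c) / k"
  have r: "r * k = 1 - c"
    using k(1) by (simp add: r_def)
  have "r > 0"
    using \<open>c < 1\<close> k(1) by (simp add: r_def)
  have "(1 - c) * (1 - c) < (1 - c) * (1 + c)"
    using \<open>c < 1\<close> c by (intro mult_strict_left_mono) auto
  also have "\<dots> = k\<^sup>2"
    using c by (simp add: algebra_simps power2_eq_square)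
  finally have "1 - c < k"
    using k(1) \<open>c < 1\<close> by (intro power2_less_imp_less[of "1 - c" k]) (auto simp: power2_eq_square)
  then have "r < 1"
    using k(1) by (simp add: r_def)
  have "k * (2 * r) = k * (k * (1 + r\<^sup>2))"
  proof -
    have "k * (k * (1 + r\<^sup>2)) = k\<^sup>2 + (r * k)\<^sup>2"
      by (simp add: power2_eq_square algebra_simps)
    also have "\<dots> = k\<^sup>2 + (1 - 2 * c + c\<^sup>2)"
      unfolding r by (simp add: power2_eq_square algebra_simps)
    also have "\<dots> = 2 * (r * k)"
      unfolding r c(1) by simp
    finally show ?thesis by (simp only: mult_ac)
  qed
  then have r_eq: "2 * r = k * (1 + r\<^sup>2)"
    using k(1) mult_left_cancel[of k] by blast
  \<comment> \<open>The third equation solved for \<open>\<rho>\<^sup>2\<close>.\<close>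
  define \<rho> where "\<rho> = sqrt (cos (\<alpha> + \<beta>) / cos (\<alpha> - \<beta>))"
  have \<rho>2: "\<rho>\<^sup>2 = cos (\<alpha> + \<beta>) / cos (\<alpha> - \<beta>)" "\<rho> > 0"
    using pos by (auto simp: \<rho>_def)
  have plus: "1 + \<rho>\<^sup>2 = 2 * cos \<alpha> * cos \<beta> / cos (\<alpha> - \<beta>)"
    unfolding \<rho>2(1) using pos(6) by (simp add: field_simps) (simp add: cos_add cos_diff)
  have minus: "1 - \<rho>\<^sup>2 = 2 * sin \<alpha> * sin \<beta> / cos (\<alpha> - \<beta>)"
    unfolding \<rho>2(1) using pos(6) by (simp add: field_simps) (simp add: cos_add cos_diff)
  have "1 - \<rho>\<^sup>2 > 0"
    unfolding minus using pos by simp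
  then have "\<rho> < 1"
    using \<rho>2(2) by (intro power2_less_imp_less[of \<rho> 1]) auto
  have "(2 * \<rho> * cos \<beta>)\<^sup>2 = (k * (1 + \<rho>\<^sup>2))\<^sup>2"
  proof -
    have "cos (\<alpha> + \<beta>) * cos (\<alpha> - \<beta>) = cos \<alpha> ^ 2 * cos \<beta> ^ 2 - sin \<alpha> ^ 2 * sin \<beta> ^ 2"
      by (simp add: cos_add cos_diff power2_eq_square algebra_simps)
    also have "\<dots> = k\<^sup>2 * cos \<alpha> ^ 2"
      unfolding k(2) cos_squared_eq[of \<beta>] sin_squared_eq[of \<alpha>] by (simp add: algebra_simps)
    finally have e: "cos (\<alpha> + \<beta>) * cos (\<alpha> - \<beta>) = k\<^sup>2 * cos \<alpha> ^ 2" .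
    have "(k * (1 + \<rho>\<^sup>2))\<^sup>2 = 4 * cos \<beta> ^ 2 * (k\<^sup>2 * cos \<alpha> ^ 2) / cos (\<alpha> - \<beta>) ^ 2"
      unfolding plus by (simp add: power_mult_distrib power_divide)
    also have "\<dots> = 4 * cos \<beta> ^ 2 * \<rho>\<^sup>2"
      unfolding e[symmetric] \<rho>2(1) using pos(6) by (simp add: field_simps power2_eq_square)
    finally show ?thesis
      by (simp add: power_mult_distrib)
  qed
  then have "2 * \<rho> * cos \<beta> = k * (1 + \<rho>\<^sup>2)"
    using pos \<rho>2(2) k(1) by (elim power2_eq_imp_eq) auto
  moreover have "(1 - \<rho>\<^sup>2) * cos \<alpha> * cos \<beta> = (1 + \<rho>\<^sup>2) * sin \<alpha> * sin \<beta>"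
    unfolding plus minus by simp
  ultimately show ?thesis
    using that[of r \<rho>] \<open>r > 0\<close> \<open>r < 1\<close> \<rho>2(2) \<open>\<rho> < 1\<close> r_eq by blast
qed

section \<open>Angles and rotations of the triangle with vertices r, \<rho> cis \<beta> and
  0\<close>

context
  fixes \<alpha> \<beta> k r \<rho> :: real
  assumes ang: "0 < \<alpha>" "0 < \<beta>" "\<alpha> + \<beta> < pi / 2" and k: "k > 0"
    and r: "0 < r" "r < 1" "2 * r = k * (1 + r\<^sup>2)"
    and \<rho>: "0 < \<rho>" "\<rho> < 1" "2 * \<rho> * cos \<beta> = k * (1 + \<rho>\<^sup>2)"
      "(1 - \<rho>\<^sup>2) * cos \<alpha> * cos \<beta> = (1 + \<rho>\<^sup>2) * sin \<alpha> * sin \<beta>"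
begin

lemma trig_pos: "cos \<alpha> > 0" "cos \<beta> > 0" "sin \<alpha> > 0" "sin \<beta> > 0"
  using ang by (auto intro!: cos_gt_zero_pi sin_gt_zero)

lemma squares_less_1: "r\<^sup>2 < 1" "\<rho>\<^sup>2 < 1"
  using r \<rho> by (auto simp: power_less_one_iff)

text \<open>Elimination of \<open>k\<close> between the two tanh equations; it is what makes the
  angle at \<open>r\<close> a right one.\<close>

lemma r_\<rho>: "\<rho> * cos \<beta> * (1 + r\<^sup>2) = r * (1 + \<rho>\<^sup>2)"
proof -
  have "2 * (\<rho> * cos \<beta> * (1 + r\<^sup>2)) = (2 * \<rho> * cos \<beta>) * (1 + r\<^sup>2)"
    by simp
  also have "\<dots> = (k * (1 + r\<^sup>2)) * (1 + \<rho>\<^sup>2)"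
    unfolding \<rho>(3) by simp
  also have "\<dots> = 2 * (r * (1 + \<rho>\<^sup>2))"
    unfolding r(3)[symmetric] by simp
  finally show ?thesis by simp
qed

lemma hyp_angle_right: "hyp_angle (of_real r) (of_real \<rho> * cis \<beta>) 0 = pi / 2"
proof -
  let ?v = "of_real \<rho> * cis \<beta>"
  have "- of_real r * (1 - of_real r * ?v) * cnj (?v - of_real r) =
      of_real (r * \<rho> * sin \<beta> * (1 - r\<^sup>2)) * cis (pi / 2)"
  proof (rule complex_eqI)
    have "Re (- of_real r * (1 - of_real r * ?v) * cnj (?v - of_real r))
        = - r * (\<rho> * cos \<beta> * (1 + r\<^sup>2) - r * (1 + \<rho>\<^sup>2 * sin \<beta> ^ 2 + \<rho>\<^sup>2 * cos \<beta> ^ 2))"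
      by (simp add: power2_eq_square algebra_simps)
    moreover have "1 + \<rho>\<^sup>2 * sin \<beta> ^ 2 + \<rho>\<^sup>2 * cos \<beta> ^ 2 = 1 + \<rho>\<^sup>2"
      by (simp add: sin_squared_eq algebra_simps)
    ultimately show "Re (- of_real r * (1 - of_real r * ?v) * cnj (?v - of_real r))
        = Re (of_real (r * \<rho> * sin \<beta> * (1 - r\<^sup>2)) * cis (pi / 2))"
      using r_\<rho> by simp
    show "Im (- of_real r * (1 - of_real r * ?v) * cnj (?v - of_real r))
        = Im (of_real (r * \<rho> * sin \<beta> * (1 - r\<^sup>2)) * cis (pi / 2))"
      by (simp add: power2_eq_square algebra_simps)
  qed
  then have "Arg (- of_real r * (1 - of_real r * ?v) / (?v - of_real r)) = pi / 2"
    using r(1) \<rho>(1) trig_pos squares_less_1 by (elim Arg_divide_eqI) auto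
  moreover have "to_origin (of_real r) 0 / to_origin (of_real r) ?v
      = - of_real r * (1 - of_real r * ?v) / (?v - of_real r)"
    by (simp add: to_origin_def)
  ultimately show ?thesis
    by (simp only: hyp_angle_def) simp
qed

lemma hyp_angle_alpha: "hyp_angle (of_real \<rho> * cis \<beta>) 0 (of_real r) = \<alpha>"
proof -
  let ?v = "of_real \<rho> * cis \<beta>"
  \<comment> \<open>Read off from the imaginary part of the product computed below;
    \<open>s'\<close> is the matching real part.\<close>
  define s where "s = r * (1 - \<rho>\<^sup>2) * sin \<beta> / sin \<alpha>"
  have s: "s * sin \<alpha> = r * (1 - \<rho>\<^sup>2) * sin \<beta>" "s > 0"
    using trig_pos r squares_less_1 by (auto simp: s_def)
  have s': "s * cos \<alpha> = \<rho> * (1 + r\<^sup>2) - r * (1 + \<rho>\<^sup>2) * cos \<beta>"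
  proof -
    have "sin \<alpha> * cos \<beta> * (s * cos \<alpha>) = r * sin \<beta> * ((1 - \<rho>\<^sup>2) * cos \<alpha> * cos \<beta>)"
      using s(1) by (metis (no_types, opaque_lifting) mult.assoc mult.commute)
    also have "\<dots> = sin \<alpha> * (r * (1 + \<rho>\<^sup>2) * sin \<beta> ^ 2)"
      unfolding \<rho>(4) by (simp add: power2_eq_square mult_ac)
    also have "r * (1 + \<rho>\<^sup>2) * sin \<beta> ^ 2 = cos \<beta> * (\<rho> * (1 + r\<^sup>2) - r * (1 + \<rho>\<^sup>2) * cos \<beta>)"
      unfolding sin_squared_eq using r_\<rho> by (simp add: power2_eq_square algebra_simps)
    finally show ?thesis
      using trig_pos by simp
  qed
  have "(?v - of_real r) * cnj (?v * (1 - of_real r * cnj ?v)) = of_real (\<rho> * s) * cis \<alpha>"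
  proof -
    have "(?v - of_real r) * cnj (?v * (1 - of_real r * cnj ?v))
        = of_real \<rho> * (of_real \<rho> * (cis \<beta> * cnj (cis \<beta>)) - of_real r * cnj (cis \<beta>)
            - of_real (r * \<rho>\<^sup>2) * (cis \<beta> * (cis \<beta> * cnj (cis \<beta>)))
            + of_real (r\<^sup>2 * \<rho>) * (cis \<beta> * cnj (cis \<beta>)))"
      by (simp add: power2_eq_square algebra_simps)
    also have "\<dots> = of_real \<rho> * (of_real (\<rho> * (1 + r\<^sup>2)) - of_real r * cis (-\<beta>) - of_real (r * \<rho>\<^sup>2) * cis \<beta>)"
      by (simp add: cis_cnj cis_mult algebra_simps)
    also have "of_real (\<rho> * (1 + r\<^sup>2)) - of_real r * cis (-\<beta>) - of_real (r * \<rho>\<^sup>2) * cis \<beta> = of_real s * cis \<alpha>"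
      using s(1) s' by (intro complex_eqI) (simp_all add: algebra_simps)
    finally show ?thesis by simp
  qed
  then have "Arg ((?v - of_real r) / (?v * (1 - of_real r * cnj ?v))) = \<alpha>"
    using s(2) \<rho>(1) ang by (elim Arg_divide_eqI) auto
  moreover have "to_origin ?v (of_real r) / to_origin ?v 0 = (?v - of_real r) / (?v * (1 - of_real r * cnj ?v))"
    by (simp add: to_origin_def divide_simps) (simp add: algebra_simps)
  ultimately show ?thesis
    using ang(1) by (simp add: hyp_angle_def)
qed

lemma hyp_angle_beta: "hyp_angle 0 (of_real r) (of_real \<rho> * cis \<beta>) = \<beta>"
proof -
  have "Arg (of_real \<rho> * cis \<beta> / of_real r) = \<beta>"
    using ang r(1) \<rho>(1) by (intro Arg_divide_eqI[of _ _ "\<rho> * r"]) auto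
  then show ?thesis
    using ang(2) by (simp add: hyp_angle_def to_origin_def)
qed

text \<open>Up to a scalar the half-turn depends on \<open>r\<close> only through
  \<open>2 * r / (1 + r\<^sup>2) = k\<close>, and its matrix has trace zero like
  \<open>S\<close>.\<close>

lemma rot_mat_right: "rot_mat (of_real r) pi = mat (of_real (- (1 + r\<^sup>2))) ** mat2 1 (- of_real k) (of_real k) (-1)"
proof -
  have "complex_of_real (2 * r) = of_real (k * (1 + r\<^sup>2))"
    using r(3) by simp
  then show ?thesis
    unfolding rot_mat_def mat_eq_mat2 by (simp add: algebra_simps power2_eq_square)
qed

text \<open>The last factor is the rotation about 0 by \<open>- 2 * \<beta>\<close>, so this is the
  classical relation between the rotations about the vertices of a triangle by twice its
  angles.\<close>

lemma rot_mat_alpha: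
  obtains l where "l \<noteq> 0"
    "rot_mat (of_real \<rho> * cis \<beta>) (2 * \<alpha>) =
       mat l ** (mat2 1 (- of_real k) (of_real k) (-1) ** mat2 1 0 0 (cis (2 * \<beta>)))"
proof -
  define \<epsilon> \<eta> where "\<epsilon> = cis \<alpha>" and "\<eta> = cis \<beta>"
  define \<tau> where "\<tau> = of_real (2 * sin \<alpha>) * \<i>"
  define l where "l = \<epsilon>\<^sup>2 - of_real (\<rho>\<^sup>2)"
  have unit: "\<epsilon> * cnj \<epsilon> = 1" "\<eta> * cnj \<eta> = 1"
    by (simp_all add: \<epsilon>_def \<eta>_def cis_cnj cis_mult)
  have double: "\<epsilon>\<^sup>2 = cis (2 * \<alpha>)" "\<eta>\<^sup>2 = cis (2 * \<beta>)"
    by (simp_all add: \<epsilon>_def \<eta>_def Complex.DeMoivre)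
  have \<tau>: "\<epsilon> - cnj \<epsilon> = \<tau>" "cnj \<tau> = - \<tau>"
    by (simp_all add: \<epsilon>_def \<tau>_def complex_eq_iff)
  have \<rho>': "k * (1 - \<rho>\<^sup>2) * cos \<alpha> = 2 * \<rho> * sin \<alpha> * sin \<beta>"
  proof -
    have "(1 + \<rho>\<^sup>2) * (k * (1 - \<rho>\<^sup>2) * cos \<alpha>) = (k * (1 + \<rho>\<^sup>2)) * (1 - \<rho>\<^sup>2) * cos \<alpha>"
      by simp
    also have "\<dots> = 2 * \<rho> * ((1 - \<rho>\<^sup>2) * cos \<alpha> * cos \<beta>)"
      unfolding \<rho>(3)[symmetric] by simp
    also have "\<dots> = (1 + \<rho>\<^sup>2) * (2 * \<rho> * sin \<alpha> * sin \<beta>)"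
      unfolding \<rho>(4) by simp
    finally have "(1 + \<rho>\<^sup>2) * (k * (1 - \<rho>\<^sup>2) * cos \<alpha>) = (1 + \<rho>\<^sup>2) * (2 * \<rho> * sin \<alpha> * sin \<beta>)" .
    moreover have "1 + \<rho>\<^sup>2 \<noteq> 0"
      by (metis add_pos_nonneg less_irrefl zero_le_power2 zero_less_one)
    ultimately show ?thesis
      using mult_left_cancel[of "1 + \<rho>\<^sup>2"] by blast
  qed
  \<comment> \<open>The matrix entries below are reduced to this complex equation: its real part is
    \<open>\<rho>'\<close>, its imaginary part is \<open>\<rho>(3)\<close> times
    \<open>sin \<alpha>\<close>.\<close>
  have K: "of_real k * (\<epsilon> - of_real (\<rho>\<^sup>2) * cnj \<epsilon>) = \<tau> * of_real \<rho> * cnj \<eta>"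
  proof (rule complex_eqI)
    show "Re (of_real k * (\<epsilon> - of_real (\<rho>\<^sup>2) * cnj \<epsilon>)) = Re (\<tau> * of_real \<rho> * cnj \<eta>)"
      using \<rho>' by (simp add: \<epsilon>_def \<eta>_def \<tau>_def algebra_simps)
    have "Im (of_real k * (\<epsilon> - of_real (\<rho>\<^sup>2) * cnj \<epsilon>)) = (k * (1 + \<rho>\<^sup>2)) * sin \<alpha>"
      by (simp add: \<epsilon>_def algebra_simps)
    then show "Im (of_real k * (\<epsilon> - of_real (\<rho>\<^sup>2) * cnj \<epsilon>)) = Im (\<tau> * of_real \<rho> * cnj \<eta>)"
      unfolding \<rho>(3)[symmetric] by (simp add: \<eta>_def \<tau>_def algebra_simps)
  qed
  have K': "of_real k * (cnj \<epsilon> - of_real (\<rho>\<^sup>2) * \<epsilon>) = - (\<tau> * of_real \<rho> * \<eta>)"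
    using arg_cong[OF K, of cnj] by (simp add: \<tau>)
  have e: "1 - \<epsilon>\<^sup>2 = - (\<epsilon> * \<tau>)"
    unfolding \<tau>(1)[symmetric] using unit by (simp add: power2_eq_square algebra_simps)
  have lk: "l * of_real k = \<epsilon> * (\<tau> * of_real \<rho> * cnj \<eta>)"
  proof -
    have "l = \<epsilon> * (\<epsilon> - of_real (\<rho>\<^sup>2) * cnj \<epsilon>)"
      using unit by (simp add: l_def power2_eq_square algebra_simps)
    then show ?thesis
      using K by (simp add: mult_ac)
  qed
  have lk': "of_real k * (1 - of_real (\<rho>\<^sup>2) * \<epsilon>\<^sup>2) = - (\<epsilon> * (\<tau> * of_real \<rho> * \<eta>))"
  proof -
    have "1 - of_real (\<rho>\<^sup>2) * \<epsilon>\<^sup>2 = \<epsilon> * (cnj \<epsilon> - of_real (\<rho>\<^sup>2) * \<epsilon>)"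
      using unit by (simp add: power2_eq_square algebra_simps)
    then show ?thesis
      using K' by (simp add: mult_ac)
  qed
  have \<eta>\<eta>: "cnj \<eta> * \<eta>\<^sup>2 = \<eta>"
    using unit(2) by (simp add: power2_eq_square mult_ac)
  have e11: "\<epsilon>\<^sup>2 - of_real \<rho> * \<eta> * (of_real \<rho> * cnj \<eta>) = l"
    using unit(2) by (simp add: l_def power2_eq_square mult_ac)
  have e12: "of_real \<rho> * \<eta> * (1 - \<epsilon>\<^sup>2) = - (l * of_real k * \<eta>\<^sup>2)"
    unfolding e lk using \<eta>\<eta> by (simp add: mult_ac)
  have e21: "of_real \<rho> * cnj \<eta> * (\<epsilon>\<^sup>2 - 1) = l * of_real k"
    unfolding lk minus_diff_eq[of 1 "\<epsilon>\<^sup>2", symmetric] e by (simp add: mult_ac)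
  have "of_real k * (1 - of_real (\<rho>\<^sup>2) * \<epsilon>\<^sup>2) = of_real k * (- (l * \<eta>\<^sup>2))"
    unfolding lk' using lk \<eta>\<eta> by (metis mult.assoc mult.commute mult_minus_right)
  then have e22: "1 - of_real (\<rho>\<^sup>2) * \<epsilon>\<^sup>2 = - (l * \<eta>\<^sup>2)"
    using k by (metis mult_left_cancel of_real_eq_0_iff less_irrefl)
  have e22': "1 - of_real \<rho> * cnj \<eta> * \<epsilon>\<^sup>2 * (of_real \<rho> * \<eta>) = - (l * \<eta>\<^sup>2)"
  proof -
    have "of_real \<rho> * cnj \<eta> * \<epsilon>\<^sup>2 * (of_real \<rho> * \<eta>) = of_real (\<rho>\<^sup>2) * \<epsilon>\<^sup>2 * (\<eta> * cnj \<eta>)"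
      by (simp add: power2_eq_square mult_ac)
    then show ?thesis
      by (simp only: e22 unit(2) mult_1_right)
  qed
  have exp: "exp (\<i> * of_real (2 * \<alpha>)) = \<epsilon>\<^sup>2"
    by (simp add: double(1) cis_conv_exp)
  show ?thesis
  proof
    have "norm (\<epsilon>\<^sup>2) = 1" by (simp add: \<epsilon>_def norm_power)
    moreover have "norm (complex_of_real (\<rho>\<^sup>2)) < 1"
      using squares_less_1 by (simp add: norm_power)
    ultimately show "l \<noteq> 0"
      unfolding l_def by (metis eq_iff_diff_eq_0 less_irrefl)
    show "rot_mat (of_real \<rho> * cis \<beta>) (2 * \<alpha>) =
       mat l ** (mat2 1 (- of_real k) (of_real k) (-1) ** mat2 1 0 0 (cis (2 * \<beta>)))"
    proof -
      have "rot_mat (of_real \<rho> * \<eta>) (2 * \<alpha>) =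
          mat2 (\<epsilon>\<^sup>2 - of_real \<rho> * \<eta> * (of_real \<rho> * cnj \<eta>)) (of_real \<rho> * \<eta> * (1 - \<epsilon>\<^sup>2))
            (of_real \<rho> * cnj \<eta> * (\<epsilon>\<^sup>2 - 1)) (1 - of_real \<rho> * cnj \<eta> * \<epsilon>\<^sup>2 * (of_real \<rho> * \<eta>))"
        unfolding rot_mat_def exp by (simp add: algebra_simps)
      then show ?thesis
        unfolding e11 e12 e21 e22' \<eta>_def[symmetric] double(2)[symmetric]
        by (simp add: mat_eq_mat2)
    qed
  qed
qed

end

subsection \<open>The triangle group\<close>

lemma pgl_imageI: "A \<in> G \<Longrightarrow> c \<noteq> 0 \<Longrightarrow> mat c ** A \<in> pgl_image G"
  unfolding pgl_image_def by blast

lemma pgl_image_mult: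
  assumes "\<And>A B. A \<in> G \<Longrightarrow> B \<in> G \<Longrightarrow> A ** B \<in> G" "X \<in> pgl_image G" "Y \<in> pgl_image G"
  shows "X ** Y \<in> pgl_image G"
proof -
  obtain A c B d where X: "X = mat c ** A" "A \<in> G" "c \<noteq> 0" and Y: "Y = mat d ** B" "B \<in> G" "d \<noteq> 0"
    using assms(2,3) unfolding pgl_image_def by blast
  have "X ** Y = mat (c * d) ** (A ** B)"
    unfolding X Y by (metis mat_mult_left_commute mat_mult_mat matrix_mul_assoc)
  then show ?thesis
    using X Y assms(1) by (auto intro: pgl_imageI)
qed

lemma matrix_inv_scale:
  fixes A :: "complex^2^2"
  assumes "c \<noteq> 0" "invertible A"
  shows "matrix_inv (mat c ** A) = mat (inverse c) ** matrix_inv A"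
  using assms by (simp add: matrix_inv_mult invertible_mat matrix_inv_mat mat_mult_commute)

context triangle_lattice
begin

lemma S_invertible: "invertible S"
  using S_in_Gamma by (simp add: Gamma_def GL2_def)

text \<open>The scalars \<open>x\<close>, \<open>y\<close> are left open because the rotation
  matrices agree with \<open>S\<close> and \<open>S ** D\<close> only projectively. \<open>D\<close>
  is recovered as \<open>S ** (S ** D)\<close> up to \<open>\<kappa>\<close>.\<close>

lemma pgl_image_eq_proj_gen:
  assumes "x \<noteq> 0" "y \<noteq> 0"
  shows "pgl_image \<Gamma> = proj_gen (mat x ** S) (mat y ** (S ** D))"
    (is "_ = proj_gen ?R1 ?R2")
proof
  have D: "D \<in> \<Gamma>"
    using diag_in_Gamma[of 1] by (simp add: D_def)
  have SD: "S ** D \<in> \<Gamma>"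
    by (intro Gamma_mult S_in_Gamma D)
  have inv: "invertible (S ** D)"
    using SD by (simp add: Gamma_def GL2_def)
  have one: "mat 1 \<in> \<Gamma>"
    using diag_in_Gamma[of 0] by (simp add: mat_eq_mat2)
  show "proj_gen ?R1 ?R2 \<subseteq> pgl_image \<Gamma>"
  proof (rule proj_gen_subset)
    show "?R1 \<in> pgl_image \<Gamma>" "?R2 \<in> pgl_image \<Gamma>"
      using assms S_in_Gamma SD by (auto intro: pgl_imageI)
    show "matrix_inv ?R1 \<in> pgl_image \<Gamma>" "matrix_inv ?R2 \<in> pgl_image \<Gamma>"
      using assms by (simp_all add: matrix_inv_scale S_invertible inv pgl_imageI Gamma_inverse S_in_Gamma SD)
    show "mat c \<in> pgl_image \<Gamma>" if "c \<noteq> 0" for c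
      using pgl_imageI[OF one that] by simp
  qed (rule pgl_image_mult[OF Gamma_mult])
  have "S = mat (inverse x) ** ?R1"
    using assms by (simp add: matrix_mul_assoc mat_mult_mat)
  then have S': "S \<in> proj_gen ?R1 ?R2"
    using assms proj_gen_scale[OF proj_gen_generators(1)[of ?R1 ?R2], of "inverse x"] by simp
  have "D = mat (inverse \<kappa>) ** (S ** (mat (inverse y) ** ?R2))"
  proof -
    have "mat (inverse y) ** ?R2 = S ** D"
      using assms by (simp add: matrix_mul_assoc mat_mult_mat)
    then show ?thesis
      using kappa_nonzero by (simp add: matrix_mul_assoc S_square mat_mult_mat flip: matrix_mul_assoc[of _ S S])
  qed
  moreover have "mat (inverse \<kappa>) ** (S ** (mat (inverse y) ** ?R2)) \<in> proj_gen ?R1 ?R2"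
    using assms kappa_nonzero by (intro proj_gen_scale proj_gen_mult S' proj_gen_generators) auto
  ultimately have D': "D \<in> proj_gen ?R1 ?R2"
    by simp
  have "\<Gamma> \<subseteq> proj_gen ?R1 ?R2"
    by (rule Gamma_generated[OF S' D']) (auto intro: proj_gen.scal proj_gen_mult)
  then show "pgl_image \<Gamma> \<subseteq> proj_gen ?R1 ?R2"
    unfolding pgl_image_def by (auto intro!: proj_gen_scale)
qed

lemma triangle_group_Gamma: "triangle_group (pgl_image \<Gamma>) 2 q m"
proof -
  \<comment> \<open>By \<open>a0_c0\<close>, \<open>k\<^sup>2 = 1 - 1 / norm a\<^sub>0 ^ 2\<close>;
    with \<open>a0_norm\<close> this is the squared tanh of the leg of the triangle.\<close>
  define \<alpha> \<beta> k where "\<alpha> = pi / q" and "\<beta> = pi / m" and "k = sqrt v * norm c\<^sub>0 / norm a\<^sub>0"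
  have ang: "0 < \<alpha>" "0 < \<beta>" "\<alpha> + \<beta> < pi / 2"
    using q_ge_3 m_ge_3 hyperbolic by (auto simp: \<alpha>_def \<beta>_def)
  have k: "k > 0"
    using v_pos a0_c0(2) a0_nonzero by (simp add: k_def)
  have "k\<^sup>2 * norm a\<^sub>0 ^ 2 = v * norm c\<^sub>0 ^ 2"
    using v_pos a0_nonzero by (simp add: k_def power_divide power_mult_distrib)
  then have "k\<^sup>2 * norm a\<^sub>0 ^ 2 = norm a\<^sub>0 ^ 2 - 1"
    using a0_c0(1) by simp
  then have "k\<^sup>2 * norm a\<^sub>0 ^ 2 * sin \<beta> ^ 2 = (norm a\<^sub>0 ^ 2 - 1) * sin \<beta> ^ 2"
    by simp
  then have k2: "k\<^sup>2 * cos \<alpha> ^ 2 = cos \<alpha> ^ 2 - sin \<beta> ^ 2"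
    using a0_norm by (simp add: \<alpha>_def \<beta>_def algebra_simps)
  obtain r \<rho> where r: "0 < r" "r < 1" and \<rho>: "0 < \<rho>" "\<rho> < 1"
    and eqs: "2 * r = k * (1 + r\<^sup>2)" "2 * \<rho> * cos \<beta> = k * (1 + \<rho>\<^sup>2)"
      "(1 - \<rho>\<^sup>2) * cos \<alpha> * cos \<beta> = (1 + \<rho>\<^sup>2) * sin \<alpha> * sin \<beta>"
    by (rule right_triangle_parameters[OF ang k k2])
  note par = ang k r eqs(1) \<rho> eqs(2,3)
  let ?v = "of_real \<rho> * cis \<beta>"
  have "Im ?v > 0"
    using \<rho> ang by (auto intro!: sin_gt_zero mult_pos_pos)
  then have "of_real r \<noteq> ?v"
    by (metis Im_complex_of_real less_irrefl)
  then have tri: "hyp_triangle (of_real r) ?v 0 2 q m"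
    using r \<rho> hyp_angle_right[OF par] hyp_angle_alpha[OF par] hyp_angle_beta[OF par]
    by (auto simp: hyp_triangle_def norm_mult \<alpha>_def \<beta>_def)
  \<comment> \<open>Since \<open>norm n ^ 2 = v\<close>, the matrix \<open>M\<close>, which swaps
    the coordinates and scales one by \<open>n\<close>, carries the invariant form to that of the
    unit disc and the fixed point of \<open>D\<close> to 0. The phase of \<open>n\<close> makes
    \<open>S\<close> correspond to a real matrix.\<close>
  define n where "n = of_real (sqrt v) * (of_real (norm c\<^sub>0) * a\<^sub>0 / (of_real (norm a\<^sub>0) * c\<^sub>0))"
  have n: "n \<noteq> 0"
    using v_pos a0_c0(2) a0_nonzero by (simp add: n_def)
  define M where "M = mat2 0 n 1 0"
  have M: "invertible M" "matrix_inv M = mat2 0 1 (1 / n) 0"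
    using matrix_inv_eqI[of M "mat2 0 1 (1 / n) 0"] n by (simp_all add: M_def mat_eq_mat2)
  have kn: "of_real k / n = c\<^sub>0 / a\<^sub>0"
    using v_pos a0_c0(2) a0_nonzero by (simp add: k_def n_def field_simps)
  have nk: "n * of_real k = \<kappa> * of_real v * cnj c\<^sub>0 / a\<^sub>0"
  proof -
    have "n * of_real k = of_real (sqrt v) ^ 2 * (of_real (norm c\<^sub>0) ^ 2 / c\<^sub>0) * (a\<^sub>0 / of_real (norm a\<^sub>0) ^ 2)"
      by (simp add: n_def k_def power2_eq_square mult_ac)
    also have "\<dots> = of_real v * cnj c\<^sub>0 / cnj a\<^sub>0"
      using v_pos a0_c0(2) a0_nonzero
      by (simp add: of_real_norm_power2 flip: of_real_power[of "sqrt v"])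
    also have "\<dots> = \<kappa> * of_real v * cnj c\<^sub>0 / a\<^sub>0"
      using a0_phase a0_nonzero by (simp add: field_simps)
    finally show ?thesis .
  qed
  have S1: "matrix_inv M ** mat2 1 (- of_real k) (of_real k) (-1) ** M = mat (- 1 / a\<^sub>0) ** S"
    unfolding M(2) unfolding M_def S_def mat_eq_mat2
    using kn nk a0_nonzero n by (simp add: mult_ac)
  have D1: "matrix_inv M ** mat2 1 0 0 (cis (2 * \<beta>)) ** M = D"
    unfolding M(2) unfolding M_def using n by (simp add: D_def zeta_cis \<beta>_def)
  have conj: "matrix_inv M ** (X ** Y) ** M = (matrix_inv M ** X ** M) ** (matrix_inv M ** Y ** M)" for X Y
  proof -
    have "(matrix_inv M ** X ** M) ** (matrix_inv M ** Y ** M) = matrix_inv M ** X ** (M ** matrix_inv M) ** Y ** M"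
      by (simp add: matrix_mul_assoc)
    then show ?thesis
      using matrix_inv_cancel(1)[OF M(1)] by (simp add: matrix_mul_assoc)
  qed
  have scale: "matrix_inv M ** (mat x ** X) ** M = mat x ** (matrix_inv M ** X ** M)" for x X
    by (metis mat_mult_commute matrix_mul_assoc)
  obtain l where l: "l \<noteq> 0" "rot_mat ?v (2 * \<alpha>) =
      mat l ** (mat2 1 (- of_real k) (of_real k) (-1) ** mat2 1 0 0 (cis (2 * \<beta>)))"
    by (rule rot_mat_alpha[OF par])
  define x where "x = of_real (- (1 + r\<^sup>2)) * (- 1 / a\<^sub>0)"
  have "complex_of_real (- (1 + r\<^sup>2)) \<noteq> 0"
    unfolding of_real_eq_0_iff neg_equal_0_iff_equal
    by (metis add_pos_nonneg less_irrefl zero_le_power2 zero_less_one)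
  moreover have "- 1 / a\<^sub>0 \<noteq> 0"
    using a0_nonzero by simp
  ultimately have x: "x \<noteq> 0"
    unfolding x_def mult_eq_0_iff by blast
  have R1: "matrix_inv M ** rot_mat (of_real r) pi ** M = mat x ** S"
    unfolding rot_mat_right[OF par] scale S1 x_def by (simp add: matrix_mul_assoc mat_mult_mat)
  have R2: "matrix_inv M ** rot_mat ?v (2 * \<alpha>) ** M = mat (l * (- 1 / a\<^sub>0)) ** (S ** D)"
    unfolding l(2) scale unfolding conj S1 D1 by (simp add: matrix_mul_assoc mat_mult_mat)
  have "l * (- 1 / a\<^sub>0) \<noteq> 0"
    using l(1) a0_nonzero by simp
  then have "pgl_image \<Gamma> = proj_gen (matrix_inv M ** rot_mat (of_real r) pi ** M)
      (matrix_inv M ** rot_mat ?v (2 * \<alpha>) ** M)"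
    unfolding R1 R2 by (rule pgl_image_eq_proj_gen[OF x])
  moreover have "2 * \<alpha> = 2 * pi / q" by (simp add: \<alpha>_def)
  ultimately show ?thesis
    unfolding triangle_group_def using M(1) tri by auto
qed

end

subsection \<open>Norms from the real cyclotomic fields\<close>

text \<open>Infinite descent: halving a nonzero solution with even coordinates lowers the sum of
  their absolute values. Forms in two variables use it with \<open>C = 0\<close>.\<close>

lemma parity_descent:
  fixes P :: "int \<Rightarrow> int \<Rightarrow> int \<Rightarrow> bool"
  assumes even: "\<And>A B C. P A B C \<Longrightarrow> even A \<and> even B \<and> even C"
    and half: "\<And>A B C. P (2 * A) (2 * B) (2 * C) \<Longrightarrow> P A B C"
    and "P A B C"
  shows "A = 0 \<and> B = 0 \<and> C = 0"
  using assms(3)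
proof (induction "nat (\<bar>A\<bar> + \<bar>B\<bar> + \<bar>C\<bar>)" arbitrary: A B C rule: less_induct)
  case less
  obtain A' B' C' where eq: "A = 2 * A'" "B = 2 * B'" "C = 2 * C'"
    using even[OF less.prems] by (auto elim!: evenE)
  have "P A' B' C'"
    using half less.prems unfolding eq by blast
  then have "A' = 0 \<and> B' = 0 \<and> C' = 0" if "\<bar>A\<bar> + \<bar>B\<bar> + \<bar>C\<bar> > 0"
    using that by (intro less.hyps) (auto simp: eq)
  then show ?case
    by (cases "\<bar>A\<bar> + \<bar>B\<bar> + \<bar>C\<bar> > 0") (auto simp: eq)
qed

lemma one_le_abs_of_int: "n \<noteq> 0 \<Longrightarrow> 1 \<le> \<bar>real_of_int n\<bar>"
  by linarith

text \<open>The product of \<open>f\<close> over both roots is an integral binary form in the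
  coordinates \<open>A\<close>, \<open>B\<close> of \<open>f\<close>. Anisotropy makes this integer
  nonzero unless \<open>A = B = 0\<close>.\<close>

lemma quadratic_norm:
  fixes p :: real and \<alpha> \<beta> :: int
  assumes p: "p\<^sup>2 = of_int \<alpha> * p + of_int \<beta>" and "int_fun f"
    and aniso: "\<And>A B. A\<^sup>2 + \<alpha> * A * B - \<beta> * B\<^sup>2 = 0 \<Longrightarrow> A = 0 \<and> B = 0"
  shows "f p = 0 \<Longrightarrow> f (of_int \<alpha> - p) = 0"
    and "f p \<noteq> 0 \<Longrightarrow> 1 \<le> \<bar>f p\<bar> * \<bar>f (of_int \<alpha> - p)\<bar>"
proof -
  define s where "s = of_int \<alpha> - p"
  have s: "s\<^sup>2 = of_int \<alpha> * s + of_int \<beta>"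
    using p by (simp add: s_def power2_eq_square algebra_simps)
  obtain A B where AB: "\<And>x. x\<^sup>2 = of_int \<alpha> * x + of_int \<beta> \<Longrightarrow> f x = of_int A + of_int B * x"
    using int_fun_quadratic[OF assms(2), of \<alpha> \<beta>] by blast
  have "f p * f s = of_int A ^ 2 + of_int A * of_int B * (p + s) + of_int B ^ 2 * (p * s)"
    unfolding AB[OF p] AB[OF s] by (simp add: power2_eq_square algebra_simps)
  also have "p * s = - of_int \<beta>"
    using p by (simp add: s_def power2_eq_square algebra_simps)
  finally have eq: "f p * f s = of_int (A\<^sup>2 + \<alpha> * A * B - \<beta> * B\<^sup>2)"
    by (simp add: s_def algebra_simps)
  show "f (of_int \<alpha> - p) = 0" if "f p = 0"
    using eq that aniso[of A B] AB[OF s] unfolding s_def[symmetric]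
    by (metis add.right_neutral mult_zero_left of_int_0 of_int_eq_0_iff)
  show "1 \<le> \<bar>f p\<bar> * \<bar>f (of_int \<alpha> - p)\<bar>" if "f p \<noteq> 0"
  proof -
    have "A\<^sup>2 + \<alpha> * A * B - \<beta> * B\<^sup>2 \<noteq> 0"
      using aniso[of A B] that AB[OF p] by auto
    then show ?thesis
      unfolding s_def[symmetric] abs_mult[symmetric] eq by (rule one_le_abs_of_int)
  qed
qed

text \<open>The norm of \<open>A + B x + C x\<^sup>2\<close> for a root \<open>x\<close> of \<open>x ^ 3 = \<alpha> x\<^sup>2 + \<beta> x + \<gamma>\<close>.\<close>
definition cubic_norm_form :: "int \<Rightarrow> int \<Rightarrow> int \<Rightarrow> int \<Rightarrow> int \<Rightarrow> int \<Rightarrow> int" where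
  "cubic_norm_form \<alpha> \<beta> \<gamma> A B C =
     A ^ 3 + \<alpha> * A\<^sup>2 * B + (\<alpha>\<^sup>2 + 2 * \<beta>) * A\<^sup>2 * C - \<beta> * A * B\<^sup>2 - (\<alpha> * \<beta> + 3 * \<gamma>) * A * B * C
     + (\<beta>\<^sup>2 - 2 * \<alpha> * \<gamma>) * A * C\<^sup>2 + \<gamma> * B ^ 3 + \<alpha> * \<gamma> * B\<^sup>2 * C - \<beta> * \<gamma> * B * C\<^sup>2 + \<gamma>\<^sup>2 * C ^ 3"

lemma cubic_norm_identity:
  fixes A B C p s u :: real
  shows "(A + B * p + C * p\<^sup>2) * (A + B * s + C * s\<^sup>2) * (A + B * u + C * u\<^sup>2) =
     A ^ 3 + A\<^sup>2 * B * (p + s + u) + A\<^sup>2 * C * ((p + s + u)\<^sup>2 - 2 * (p * s + p * u + s * u))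
     + A * B\<^sup>2 * (p * s + p * u + s * u)
     + A * B * C * ((p + s + u) * (p * s + p * u + s * u) - 3 * (p * s * u))
     + A * C\<^sup>2 * ((p * s + p * u + s * u)\<^sup>2 - 2 * (p + s + u) * (p * s * u))
     + B ^ 3 * (p * s * u) + B\<^sup>2 * C * (p + s + u) * (p * s * u)
     + B * C\<^sup>2 * (p * s + p * u + s * u) * (p * s * u) + C ^ 3 * (p * s * u)\<^sup>2"
  by algebra

text \<open>The argument of \<open>quadratic_norm\<close> for three roots, which enter through their
  elementary symmetric functions.\<close>

lemma cubic_norm:
  fixes p s u :: real and \<alpha> \<beta> \<gamma> :: int
  assumes sum: "p + s + u = of_int \<alpha>" and sum2: "p * s + p * u + s * u = - of_int \<beta>"
    and prod: "p * s * u = of_int \<gamma>" and "int_fun f"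
    and aniso: "\<And>A B C. cubic_norm_form \<alpha> \<beta> \<gamma> A B C = 0 \<Longrightarrow> A = 0 \<and> B = 0 \<and> C = 0"
  shows "f p = 0 \<Longrightarrow> f s = 0 \<and> f u = 0"
    and "f p \<noteq> 0 \<Longrightarrow> 1 \<le> \<bar>f p\<bar> * (\<bar>f s\<bar> * \<bar>f u\<bar>)"
proof -
  have root: "x ^ 3 = of_int \<alpha> * x\<^sup>2 + of_int \<beta> * x + of_int \<gamma>" if "x \<in> {p, s, u}" for x
  proof -
    have "(x - p) * (x - s) * (x - u) = 0" using that by auto
    moreover have "(x - p) * (x - s) * (x - u)
        = x ^ 3 - (p + s + u) * x\<^sup>2 + (p * s + p * u + s * u) * x - p * s * u"
      by algebra
    ultimately show ?thesis
      unfolding sum sum2 prod by simp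
  qed
  obtain A B C where "\<And>x. x ^ 3 = of_int \<alpha> * x\<^sup>2 + of_int \<beta> * x + of_int \<gamma> \<Longrightarrow>
      f x = of_int A + of_int B * x + of_int C * x\<^sup>2"
    using int_fun_cubic[OF assms(4), of \<alpha> \<beta> \<gamma>] by blast
  then have f: "f x = of_int A + of_int B * x + of_int C * x\<^sup>2" if "x \<in> {p, s, u}" for x
    using root that by blast
  have eq: "f p * f s * f u = of_int (cubic_norm_form \<alpha> \<beta> \<gamma> A B C)"
    using f[of p] f[of s] f[of u] cubic_norm_identity[of A B p C s u]
    unfolding sum sum2 prod by (simp add: cubic_norm_form_def algebra_simps)
  show "f s = 0 \<and> f u = 0" if "f p = 0"
  proof -
    have "cubic_norm_form \<alpha> \<beta> \<gamma> A B C = 0"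
      using eq that by simp
    then have "A = 0 \<and> B = 0 \<and> C = 0"
      by (rule aniso)
    then show ?thesis
      using f[of s] f[of u] by simp
  qed
  show "1 \<le> \<bar>f p\<bar> * (\<bar>f s\<bar> * \<bar>f u\<bar>)" if "f p \<noteq> 0"
  proof -
    have "\<not> (A = 0 \<and> B = 0 \<and> C = 0)"
      using that f[of p] by auto
    then have "cubic_norm_form \<alpha> \<beta> \<gamma> A B C \<noteq> 0"
      using aniso by blast
    then have "1 \<le> \<bar>f p * f s * f u\<bar>"
      unfolding eq by (rule one_le_abs_of_int)
    then show ?thesis
      by (simp add: abs_mult mult.assoc)
  qed
qed

text \<open>Modulo 2 the form is \<open>A\<^sup>2 + A * B + B\<^sup>2\<close>, which is odd unless
  both arguments are even.\<close>

lemma norm_form_anisotropic_10: "A\<^sup>2 + 1 * A * B - 1 * B\<^sup>2 = 0 \<Longrightarrow> A = 0 \<and> B = 0" for A B :: int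
proof -
  assume *: "A\<^sup>2 + 1 * A * B - 1 * B\<^sup>2 = 0"
  have "A = 0 \<and> B = 0 \<and> (0::int) = 0"
  proof (rule parity_descent[where P = "\<lambda>A B C. A\<^sup>2 + A * B - B\<^sup>2 = 0 \<and> C = 0"])
    show "even A \<and> even B \<and> even C" if "A\<^sup>2 + A * B - B\<^sup>2 = 0 \<and> C = 0" for A B C :: int
    proof -
      have "even (A\<^sup>2 + A * B - B\<^sup>2)" using that by simp
      then have "even A \<and> even B" by (cases "even A"; cases "even B") auto
      then show ?thesis using that by simp
    qed
  qed (use * in \<open>auto simp: power2_eq_square algebra_simps\<close>)
  then show ?thesis by simp
qed

text \<open>\<open>A\<close> and \<open>B\<close> have equal parity; if they are odd,
  \<open>A\<^sup>2\<close> is 1 and \<open>3 * B\<^sup>2\<close> is 3 modulo 4.\<close>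

lemma norm_form_anisotropic_12: "A\<^sup>2 + 0 * A * B - 3 * B\<^sup>2 = 0 \<Longrightarrow> A = 0 \<and> B = 0" for A B :: int
proof -
  assume *: "A\<^sup>2 + 0 * A * B - 3 * B\<^sup>2 = 0"
  have "A = 0 \<and> B = 0 \<and> (0::int) = 0"
  proof (rule parity_descent[where P = "\<lambda>A B C. A\<^sup>2 = 3 * B\<^sup>2 \<and> C = 0"])
    show "even A \<and> even B \<and> even C" if AB: "A\<^sup>2 = 3 * B\<^sup>2 \<and> C = 0" for A B C :: int
    proof -
      have "even (A\<^sup>2) \<longleftrightarrow> even (3 * B\<^sup>2)" using AB by simp
      then have par: "even A \<longleftrightarrow> even B" by simp
      have "even A"
      proof (rule ccontr)
        assume "odd A"
        then obtain a b where "A = 2 * a + 1" "B = 2 * b + 1"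
          using par by (auto elim!: oddE)
        then have "4 * (a * a + a) + 1 = 12 * (b * b + b) + 3"
          using AB by (simp add: power2_eq_square algebra_simps)
        then show False by presburger
      qed
      then show ?thesis using par AB by simp
    qed
  qed (use * in \<open>auto simp: power2_eq_square algebra_simps\<close>)
  then show ?thesis by simp
qed

text \<open>Modulo 2 the minimal polynomials of \<open>2 cos (pi / 7)\<close> and \<open>2 cos (pi / 9)\<close> are
  irreducible, so the norm form is odd unless all three coordinates are even.\<close>
lemma norm_form_anisotropic_14: "cubic_norm_form 1 2 (-1) A B C = 0 \<Longrightarrow> A = 0 \<and> B = 0 \<and> C = 0"
proof (rule parity_descent[where P = "\<lambda>A B C. cubic_norm_form 1 2 (-1) A B C = 0"])
  show "even A \<and> even B \<and> even C" if "cubic_norm_form 1 2 (-1) A B C = 0" for A B C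
  proof -
    have "even (cubic_norm_form 1 2 (-1) A B C)" using that by simp
    then show ?thesis
      by (cases "even A"; cases "even B"; cases "even C") (simp_all add: cubic_norm_form_def)
  qed
  show "cubic_norm_form 1 2 (-1) A B C = 0" if "cubic_norm_form 1 2 (-1) (2 * A) (2 * B) (2 * C) = 0" for A B C
  proof -
    have "cubic_norm_form 1 2 (-1) (2 * A) (2 * B) (2 * C) = 8 * cubic_norm_form 1 2 (-1) A B C"
      by (simp add: cubic_norm_form_def power2_eq_square power3_eq_cube algebra_simps)
    then show ?thesis using that by simp
  qed
qed

lemma norm_form_anisotropic_18: "cubic_norm_form 0 3 1 A B C = 0 \<Longrightarrow> A = 0 \<and> B = 0 \<and> C = 0"
proof (rule parity_descent[where P = "\<lambda>A B C. cubic_norm_form 0 3 1 A B C = 0"])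
  show "even A \<and> even B \<and> even C" if "cubic_norm_form 0 3 1 A B C = 0" for A B C
  proof -
    have "even (cubic_norm_form 0 3 1 A B C)" using that by simp
    then show ?thesis
      by (cases "even A"; cases "even B"; cases "even C") (simp_all add: cubic_norm_form_def)
  qed
  show "cubic_norm_form 0 3 1 A B C = 0" if "cubic_norm_form 0 3 1 (2 * A) (2 * B) (2 * C) = 0" for A B C
  proof -
    have "cubic_norm_form 0 3 1 (2 * A) (2 * B) (2 * C) = 8 * cubic_norm_form 0 3 1 A B C"
      by (simp add: cubic_norm_form_def power2_eq_square power3_eq_cube algebra_simps)
    then show ?thesis using that by simp
  qed
qed

subsection \<open>The four cyclotomic fields\<close>

definition p10 :: real where "p10 = 2 * cos (2 * pi / real 10)"
definition p12 :: real where "p12 = 2 * cos (2 * pi / real 12)"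
definition p14 :: real where "p14 = 2 * cos (2 * pi / real 14)"
definition p18 :: real where "p18 = 2 * cos (2 * pi / real 18)"

lemma p12_square: "p12\<^sup>2 = 3" and p12_bounds: "1.73 < p12" "p12 < 1.74"
proof -
  have "p12 = sqrt 3"
    using cos_30 by (simp add: p12_def mult.commute)
  show "p12\<^sup>2 = 3"
    unfolding \<open>p12 = sqrt 3\<close> by simp
  show "1.73 < p12"
    unfolding \<open>p12 = sqrt 3\<close> by (rule real_less_rsqrt) (simp add: power2_eq_square)
  show "p12 < 1.74"
    unfolding \<open>p12 = sqrt 3\<close> by (rule real_less_lsqrt) (simp_all add: power2_eq_square)
qed

lemma p10_square: "p10\<^sup>2 = p10 + 1" and p10_bounds: "1.61 < p10" "p10 < 1.62"
proof -
  define c where "c = cos (pi / 5)"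
  have p: "p10 = 2 * c" by (simp add: p10_def c_def mult.commute)
  have "cos (pi / 3) < cos (pi / 5)"
    by (intro cos_monotone_0_pi) auto
  then have c: "c > 1 / 2" by (simp add: c_def cos_60)
  \<comment> \<open>Both sides are polynomials in \<open>c\<close>. Their difference also vanishes
    at -1, the cosine of pi; this factor is divided out.\<close>
  have "cos (3 * (pi / 5)) = cos (pi - 2 * (pi / 5))"
    by (rule arg_cong[of _ _ cos]) simp
  then have "4 * c ^ 3 - 3 * c = - (2 * c\<^sup>2 - 1)"
    unfolding cos_treble_cos cos_pi_minus cos_double_cos c_def .
  then have "(c + 1) * (4 * c\<^sup>2 - 2 * c - 1) = 0"
    by (simp add: power2_eq_square power3_eq_cube algebra_simps)
  then have "4 * c\<^sup>2 - 2 * c - 1 = 0" using c by auto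
  then show sq: "p10\<^sup>2 = p10 + 1" by (simp add: p power2_eq_square)
  \<comment> \<open>Each product reduces by the quadratic equation to a positive constant, and its
    second factor is positive. The cubic cases below proceed alike.\<close>
  have "(p10 - 1.61) * (p10 + 0.61) > 0" "(1.62 - p10) * (p10 + 0.62) > 0"
    using sq p c by (simp_all add: power2_eq_square algebra_simps)
  then show "1.61 < p10" "p10 < 1.62"
    using p c by (auto simp: zero_less_mult_iff)
qed

lemma cos_gt_of_less_30:
  assumes "0 < x" "x < pi / 6"
  shows "2 * cos x > 1.73"
proof -
  have "cos (pi / 6) < cos x"
    using assms by (intro cos_monotone_0_pi) auto
  moreover have "(1.73::real) < sqrt 3"
    by (rule real_less_rsqrt) (simp add: power2_eq_square)
  ultimately show ?thesis by (simp add: cos_30)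
qed

lemma p14_cubic: "p14 ^ 3 = p14\<^sup>2 + 2 * p14 - 1" and p14_bounds: "1.8 < p14" "p14 < 1.81"
proof -
  define c where "c = cos (pi / 7)"
  have p: "p14 = 2 * c" by (simp add: p14_def c_def mult.commute)
  have c: "2 * c > 1.73"
    unfolding c_def by (rule cos_gt_of_less_30) auto
  have "cos (2 * (2 * (pi / 7))) = cos (pi - 3 * (pi / 7))"
    by (rule arg_cong[of _ _ cos]) simp
  then have "2 * (2 * c\<^sup>2 - 1)\<^sup>2 - 1 = - (4 * c ^ 3 - 3 * c)"
    unfolding cos_treble_cos cos_pi_minus cos_double_cos c_def .
  then have "(c + 1) * (8 * c ^ 3 - 4 * c\<^sup>2 - 4 * c + 1) = 0"
    by (simp add: power2_eq_square power3_eq_cube algebra_simps)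
  then have "8 * c ^ 3 - 4 * c\<^sup>2 - 4 * c + 1 = 0" using c by auto
  then show cub: "p14 ^ 3 = p14\<^sup>2 + 2 * p14 - 1" by (simp add: p power2_eq_square power3_eq_cube)
  have "(p14 - 1.8) * (p14 * p14 + 0.8 * p14 - 0.56) = p14 ^ 3 - p14\<^sup>2 - 2 * p14 + 1.008"
    "(1.81 - p14) * (p14 * p14 + 0.81 * p14 - 0.5339) = - 0.966359 - (p14 ^ 3 - p14\<^sup>2 - 2 * p14)"
    by (simp_all add: power2_eq_square power3_eq_cube field_simps)
  then have "(p14 - 1.8) * (p14 * p14 + 0.8 * p14 - 0.56) > 0" "(1.81 - p14) * (p14 * p14 + 0.81 * p14 - 0.5339) > 0"
    unfolding cub by simp_all
  moreover have "p14 * p14 > 1"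
    using p c by (intro less_1_mult) auto
  ultimately show "1.8 < p14" "p14 < 1.81"
    using p c by (auto simp: zero_less_mult_iff)
qed

lemma p18_cubic: "p18 ^ 3 = 3 * p18 + 1" and p18_bounds: "1.87 < p18" "p18 < 1.88"
proof -
  define c where "c = cos (pi / 9)"
  have p: "p18 = 2 * c" by (simp add: p18_def c_def mult.commute)
  have c: "2 * c > 1.73"
    unfolding c_def by (rule cos_gt_of_less_30) auto
  have "cos (3 * (pi / 9)) = cos (pi / 3)"
    by (rule arg_cong[of _ _ cos]) simp
  then have "4 * c ^ 3 - 3 * c = 1 / 2"
    unfolding cos_treble_cos cos_60 c_def .
  then show cub: "p18 ^ 3 = 3 * p18 + 1" by (simp add: p power3_eq_cube)
  have "(p18 - 1.87) * (p18 * p18 + 1.87 * p18 + 0.4969) = p18 ^ 3 - 3 * p18 - 0.929203"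
    "(1.88 - p18) * (p18 * p18 + 1.88 * p18 + 0.5344) = 1.004672 - (p18 ^ 3 - 3 * p18)"
    by (simp_all add: power3_eq_cube field_simps)
  then have "(p18 - 1.87) * (p18 * p18 + 1.87 * p18 + 0.4969) > 0" "(1.88 - p18) * (p18 * p18 + 1.88 * p18 + 0.5344) > 0"
    unfolding cub by simp_all
  moreover have "p18 * p18 > 1"
    using p c by (intro less_1_mult) auto
  ultimately show "1.87 < p18" "p18 < 1.88"
    using p c by (auto simp: zero_less_mult_iff)
qed

lemma cos_sin_half_angle:
  assumes "p = 2 * cos (2 * pi / real m)"
  shows "4 * cos (pi / m) ^ 2 = 2 + p" "4 * sin (pi / m) ^ 2 = 2 - p"
  using cos_double_cos[of "pi / m"] cos_double_sin[of "pi / m"] assms by simp_all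

text \<open>Serves \<open>unit_gap\<close>: with one conjugate \<open>2 * cos (pi / m)\<close> must
  exceed 2 - 1/4 = 7/4, with two it must exceed 2 - 1/16 = 31/16.\<close>

lemma less_cos_half_angle:
  assumes "m \<ge> 3" "p = 2 * cos (2 * pi / real m)" "b\<^sup>2 < 2 + p"
  shows "b < 2 * cos (pi / m)"
proof (rule power2_less_imp_less)
  show "b\<^sup>2 < (2 * cos (pi / m))\<^sup>2"
    using cos_sin_half_angle(1)[OF assms(2)] assms(3) by (simp add: power_mult_distrib)
  have "0 \<le> pi / m" "pi / m \<le> pi / 2"
    using assms(1) by (auto simp: field_simps)
  moreover from this have "- (pi / 2) \<le> pi / m"
    using pi_gt_zero by linarith
  ultimately show "0 \<le> 2 * cos (pi / m)"
    using cos_ge_zero[of "pi / m"] by simp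
qed

lemma conjugates_10: "cyclotomic_conjugates 10 p10 {1 - p10}"
proof
  fix f :: "real \<Rightarrow> real" and s assume f: "int_fun f"
  have p: "p10\<^sup>2 = of_int 1 * p10 + of_int 1"
    using p10_square by simp
  note norm = quadratic_norm[OF p f norm_form_anisotropic_10, simplified]
  show "f s = 0" if "f p10 = 0" "s \<in> {1 - p10}"
    using norm that by simp
  show "1 \<le> \<bar>f p10\<bar> * (\<Prod>s\<in>{1 - p10}. \<bar>f s\<bar>)" if "f p10 \<noteq> 0"
    using norm that by simp
next
  have "(7 / 4)\<^sup>2 < 2 + p10"
    using p10_bounds by (simp add: power2_eq_square)
  then show "(2 - 2 * cos (pi / real 10)) * 4 ^ card {1 - p10} < 1"
    using less_cos_half_angle[OF _ p10_def, of "7 / 4"] by simp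
qed (use p10_bounds in \<open>auto simp: p10_def\<close>)

lemma conjugates_12: "cyclotomic_conjugates 12 p12 {- p12}"
proof
  fix f :: "real \<Rightarrow> real" and s assume f: "int_fun f"
  have p: "p12\<^sup>2 = of_int 0 * p12 + of_int 3"
    using p12_square by simp
  note norm = quadratic_norm[OF p f norm_form_anisotropic_12, simplified]
  show "f s = 0" if "f p12 = 0" "s \<in> {- p12}"
    using norm that by simp
  show "1 \<le> \<bar>f p12\<bar> * (\<Prod>s\<in>{- p12}. \<bar>f s\<bar>)" if "f p12 \<noteq> 0"
    using norm that by simp
next
  have "(7 / 4)\<^sup>2 < 2 + p12"
    using p12_bounds by (simp add: power2_eq_square)
  then show "(2 - 2 * cos (pi / real 12)) * 4 ^ card {- p12} < 1"
    using less_cos_half_angle[OF _ p12_def, of "7 / 4"] by simp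
qed (use p12_bounds in \<open>auto simp: p12_def\<close>)

lemma p14_square_bounds: "3.24 < p14\<^sup>2" "p14\<^sup>2 < 3.2761"
  using p14_bounds power_strict_mono[of "1.8" p14 2] power_strict_mono[of p14 "1.81" 2]
  by (simp_all add: power2_eq_square)

lemma p18_square_bounds: "3.4969 < p18\<^sup>2" "p18\<^sup>2 < 3.5344"
  using p18_bounds power_strict_mono[of "1.87" p18 2] power_strict_mono[of p18 "1.88" 2]
  by (simp_all add: power2_eq_square)

lemma p14_power4: "p14 ^ 4 = 3 * p14\<^sup>2 + p14 - 1"
proof -
  have "p14 ^ 4 = p14 * p14 ^ 3" by (simp add: eval_nat_numeral)
  also have "\<dots> = p14 ^ 3 + 2 * p14\<^sup>2 - p14"
    by (subst p14_cubic) (simp add: algebra_simps eval_nat_numeral)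
  finally show ?thesis using p14_cubic by simp
qed

lemma p18_power4: "p18 ^ 4 = 3 * p18\<^sup>2 + p18"
proof -
  have "p18 ^ 4 = p18 * p18 ^ 3" by (simp add: eval_nat_numeral)
  also have "\<dots> = 3 * p18\<^sup>2 + p18"
    by (subst p18_cubic) (simp add: algebra_simps eval_nat_numeral)
  finally show ?thesis .
qed

text \<open>Besides \<open>p14\<close> = 2 cos (pi / 7) the roots are 2 cos (3 pi / 7) and 2 cos (5
  pi / 7), written as polynomials in \<open>p14\<close>.\<close>

lemma conjugates_14: "cyclotomic_conjugates 14 p14 {p14\<^sup>2 - p14 - 1, 2 - p14\<^sup>2}"
proof
  have neq: "p14\<^sup>2 - p14 - 1 \<noteq> 2 - p14\<^sup>2"
    using p14_bounds p14_square_bounds by simp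
  fix f :: "real \<Rightarrow> real" and s assume f: "int_fun f"
  have sum: "p14 + (p14\<^sup>2 - p14 - 1) + (2 - p14\<^sup>2) = of_int 1" by simp
  have sum2: "p14 * (p14\<^sup>2 - p14 - 1) + p14 * (2 - p14\<^sup>2) + (p14\<^sup>2 - p14 - 1) * (2 - p14\<^sup>2) = - of_int 2"
  proof -
    have "p14 * (p14\<^sup>2 - p14 - 1) + p14 * (2 - p14\<^sup>2) + (p14\<^sup>2 - p14 - 1) * (2 - p14\<^sup>2)
        = - (p14 ^ 4) + p14 ^ 3 + 2 * p14\<^sup>2 - p14 - 2"
      by (simp add: algebra_simps eval_nat_numeral)
    then show ?thesis unfolding p14_power4 p14_cubic by simp
  qed
  have prod: "p14 * (p14\<^sup>2 - p14 - 1) * (2 - p14\<^sup>2) = of_int (- 1)"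
  proof -
    have "p14 * (p14\<^sup>2 - p14 - 1) = p14 ^ 3 - p14\<^sup>2 - p14"
      by (simp add: algebra_simps eval_nat_numeral)
    also have "\<dots> = p14 - 1" unfolding p14_cubic by simp
    finally have "p14 * (p14\<^sup>2 - p14 - 1) * (2 - p14\<^sup>2) = (p14 - 1) * (2 - p14\<^sup>2)" by simp
    also have "\<dots> = - (p14 ^ 3) + p14\<^sup>2 + 2 * p14 - 2"
      by (simp add: algebra_simps eval_nat_numeral)
    finally show ?thesis unfolding p14_cubic by simp
  qed
  note norm = cubic_norm[OF sum sum2 prod f norm_form_anisotropic_14]
  show "f s = 0" if "f p14 = 0" "s \<in> {p14\<^sup>2 - p14 - 1, 2 - p14\<^sup>2}"
    using norm(1) that by auto
  show "1 \<le> \<bar>f p14\<bar> * (\<Prod>s\<in>{p14\<^sup>2 - p14 - 1, 2 - p14\<^sup>2}. \<bar>f s\<bar>)" if "f p14 \<noteq> 0"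
    using norm(2)[OF _ that] neq by simp
next
  have neq: "p14\<^sup>2 - p14 - 1 \<noteq> 2 - p14\<^sup>2"
    using p14_bounds p14_square_bounds by simp
  have "(31 / 16)\<^sup>2 < 2 + p14"
    using p14_bounds by (simp add: power2_eq_square)
  then have "31 / 16 < 2 * cos (pi / real 14)"
    by (intro less_cos_half_angle[OF _ p14_def]) simp
  then show "(2 - 2 * cos (pi / real 14)) * 4 ^ card {p14\<^sup>2 - p14 - 1, 2 - p14\<^sup>2} < 1"
    using neq by simp
qed (use p14_bounds p14_square_bounds in \<open>auto simp: p14_def[symmetric] abs_if\<close>, simp add: p14_def)

text \<open>Besides \<open>p18\<close> = 2 cos (pi / 9) the roots are 2 cos (5 pi / 9) and 2 cos (7
  pi / 9).\<close>

lemma conjugates_18: "cyclotomic_conjugates 18 p18 {p18\<^sup>2 - p18 - 2, 2 - p18\<^sup>2}"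
proof
  have neq: "p18\<^sup>2 - p18 - 2 \<noteq> 2 - p18\<^sup>2"
    using p18_bounds p18_square_bounds by simp
  fix f :: "real \<Rightarrow> real" and s assume f: "int_fun f"
  have sum: "p18 + (p18\<^sup>2 - p18 - 2) + (2 - p18\<^sup>2) = of_int 0" by simp
  have sum2: "p18 * (p18\<^sup>2 - p18 - 2) + p18 * (2 - p18\<^sup>2) + (p18\<^sup>2 - p18 - 2) * (2 - p18\<^sup>2) = - of_int 3"
  proof -
    have "p18 * (p18\<^sup>2 - p18 - 2) + p18 * (2 - p18\<^sup>2) + (p18\<^sup>2 - p18 - 2) * (2 - p18\<^sup>2)
        = - (p18 ^ 4) + p18 ^ 3 + 3 * p18\<^sup>2 - 2 * p18 - 4"
      by (simp add: algebra_simps eval_nat_numeral)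
    then show ?thesis unfolding p18_power4 p18_cubic by simp
  qed
  have prod: "p18 * (p18\<^sup>2 - p18 - 2) * (2 - p18\<^sup>2) = of_int 1"
  proof -
    have "p18 * (p18\<^sup>2 - p18 - 2) = p18 ^ 3 - p18\<^sup>2 - 2 * p18"
      by (simp add: algebra_simps eval_nat_numeral)
    also have "\<dots> = 1 + p18 - p18\<^sup>2" unfolding p18_cubic by simp
    finally have "p18 * (p18\<^sup>2 - p18 - 2) * (2 - p18\<^sup>2) = (1 + p18 - p18\<^sup>2) * (2 - p18\<^sup>2)" by simp
    also have "\<dots> = p18 ^ 4 - p18 ^ 3 - 3 * p18\<^sup>2 + 2 * p18 + 2"
      by (simp add: algebra_simps eval_nat_numeral)
    finally show ?thesis unfolding p18_power4 p18_cubic by simp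
  qed
  note norm = cubic_norm[OF sum sum2 prod f norm_form_anisotropic_18]
  show "f s = 0" if "f p18 = 0" "s \<in> {p18\<^sup>2 - p18 - 2, 2 - p18\<^sup>2}"
    using norm(1) that by auto
  show "1 \<le> \<bar>f p18\<bar> * (\<Prod>s\<in>{p18\<^sup>2 - p18 - 2, 2 - p18\<^sup>2}. \<bar>f s\<bar>)" if "f p18 \<noteq> 0"
    using norm(2)[OF _ that] neq by simp
next
  have neq: "p18\<^sup>2 - p18 - 2 \<noteq> 2 - p18\<^sup>2"
    using p18_bounds p18_square_bounds by simp
  have "(31 / 16)\<^sup>2 < 2 + p18"
    using p18_bounds by (simp add: power2_eq_square)
  then have "31 / 16 < 2 * cos (pi / real 18)"
    by (intro less_cos_half_angle[OF _ p18_def]) simp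
  then show "(2 - 2 * cos (pi / real 18)) * 4 ^ card {p18\<^sup>2 - p18 - 2, 2 - p18\<^sup>2} < 1"
    using neq by simp
qed (use p18_bounds p18_square_bounds in \<open>auto simp: p18_def[symmetric] abs_if\<close>, simp add: p18_def)

subsection \<open>The five groups\<close>

lemma zeta_add_cnj: "zeta m + cnj (zeta m) = of_real (2 * cos (2 * pi / m))"
  by (simp add: zeta_cis complex_eq_iff)

lemma (in cyclotomic_conjugates) of_real_p_in_ring: "of_real p \<in> O\<^sub>K"
  unfolding p_def zeta_add_cnj[symmetric]
  using m_pos by (intro int_ring_gen_intros cnj_in_int_ring_gen) auto

lemma (in cyclotomic_conjugates) norm_one_plus_zeta: "norm (1 + zeta m) ^ 2 = 2 + p"
  using norm_zeta_coords[of 1 1 m] by (simp add: p_def)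

section \<open>Criteria for the types (2, 3, m) and (2, m, m)\<close>

context lorentz_lattice
begin

text \<open>For \<open>q = 3\<close> the squared sine is 3/4, and one conjugate suffices for
  \<open>column_gap\<close> to bound \<open>(norm a ^ 2 - 1) * norm a ^ 2\<close> below by 4; then
  \<open>small\<close> yields \<open>gap\<close>.\<close>

lemma triangle_group_2_3:
  assumes "m \<ge> 7"
    and "a\<^sub>0 \<in> O\<^sub>K" "c\<^sub>0 \<in> O\<^sub>K" "\<kappa> * of_real v * cnj c\<^sub>0 \<in> O\<^sub>K" "\<kappa> * cnj a\<^sub>0 = a\<^sub>0"
    and "norm a\<^sub>0 ^ 2 = 1 + v * norm c\<^sub>0 ^ 2" "c\<^sub>0 \<noteq> 0"
    and norm: "norm a\<^sub>0 ^ 2 * (2 - p) = 1" and small: "norm a\<^sub>0 ^ 2 < 12"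
    and "Q \<noteq> {}" "finite Q"
  shows "triangle_group (pgl_image (Gamma m (of_real v))) 2 3 m"
proof -
  have "triangle_lattice m p Q v W N 3 a\<^sub>0 c\<^sub>0 \<kappa>"
  proof
    have "pi / m \<le> pi / 7"
      using assms(1) by (intro divide_left_mono) auto
    moreover have "pi / 3 + pi / 7 < pi / 2"
      using pi_gt_zero by linarith
    ultimately have "pi / 3 + pi / m < pi / 2"
      by linarith
    then show "pi / real 3 + pi / m < pi / 2"
      by simp
    show "norm a\<^sub>0 ^ 2 * sin (pi / m) ^ 2 = cos (pi / real 3) ^ 2"
    proof -
      have "4 * (norm a\<^sub>0 ^ 2 * sin (pi / m) ^ 2) = norm a\<^sub>0 ^ 2 * (4 * sin (pi / m) ^ 2)"
        by simp
      also have "\<dots> = 1"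
        unfolding cos_sin_half_angle[OF p_def] by (rule norm)
      finally show ?thesis by (simp add: cos_60 power2_eq_square)
    qed
  next
    fix a c
    assume ac: "a \<in> O\<^sub>K" "c \<in> O\<^sub>K" "norm a ^ 2 = 1 + v * norm c ^ 2" "c \<noteq> 0"
    have "(4::real) ^ 1 \<le> 4 ^ card Q"
      using assms(10,11) by (intro power_increasing) (auto simp: Suc_le_eq card_gt_0_iff)
    then have "4 \<le> (norm a ^ 2 - 1) * norm a ^ 2"
      using column_gap[OF ac] by simp
    then show "norm a\<^sub>0 ^ 2 - 1 < 4 * ((norm a ^ 2 - 1) * norm a ^ 2) * sin (pi / real 3) ^ 2"
    proof -
      have "4 * X * sin (pi / real 3) ^ 2 = 3 * X" for X
        by (simp add: sin_60 power_divide)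
      then have "4 * ((norm a ^ 2 - 1) * norm a ^ 2) * sin (pi / real 3) ^ 2
          = 3 * ((norm a ^ 2 - 1) * norm a ^ 2)" .
      then show ?thesis
        using small \<open>4 \<le> _\<close> by linarith
    qed
  qed (use assms in auto)
  then show ?thesis
    by (rule triangle_lattice.triangle_group_Gamma)
qed

text \<open>For \<open>q = m\<close> the factor \<open>4 * sin (pi / m) ^ 2 = 2 - p\<close> is small
  and \<open>column_gap\<close> is too weak for the two intended cases. An explicit lower bound
  \<open>b\<close> for \<open>v * norm c ^ 2\<close> takes its place.\<close>

lemma triangle_group_2_m:
  assumes "m \<ge> 5"
    and "a\<^sub>0 \<in> O\<^sub>K" "c\<^sub>0 \<in> O\<^sub>K" "\<kappa> * of_real v * cnj c\<^sub>0 \<in> O\<^sub>K" "\<kappa> * cnj a\<^sub>0 = a\<^sub>0"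
    and "norm a\<^sub>0 ^ 2 = 1 + v * norm c\<^sub>0 ^ 2" "c\<^sub>0 \<noteq> 0"
    and norm: "norm a\<^sub>0 ^ 2 * (2 - p) = 2 + p"
    and gap: "\<And>a c. \<lbrakk>a \<in> O\<^sub>K; c \<in> O\<^sub>K; norm a ^ 2 = 1 + v * norm c ^ 2; c \<noteq> 0\<rbrakk> \<Longrightarrow> b \<le> v * norm c ^ 2"
    and b: "b \<ge> 0" "norm a\<^sub>0 ^ 2 - 1 < b * (1 + b) * (2 - p)" "p \<le> 2"
  shows "triangle_group (pgl_image (Gamma m (of_real v))) 2 m m"
proof -
  have "triangle_lattice m p Q v W N m a\<^sub>0 c\<^sub>0 \<kappa>"
  proof
    have "pi / m \<le> pi / 5"
      using assms(1) by (intro divide_left_mono) auto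
    then show "pi / m + pi / m < pi / 2"
      using pi_gt_zero by linarith
    show "norm a\<^sub>0 ^ 2 * sin (pi / m) ^ 2 = cos (pi / m) ^ 2"
    proof -
      have "4 * (norm a\<^sub>0 ^ 2 * sin (pi / m) ^ 2) = norm a\<^sub>0 ^ 2 * (4 * sin (pi / m) ^ 2)"
        by simp
      also have "\<dots> = 4 * cos (pi / m) ^ 2"
        unfolding cos_sin_half_angle[OF p_def] by (rule norm)
      finally show ?thesis by simp
    qed
  next
    fix a c
    assume ac: "a \<in> O\<^sub>K" "c \<in> O\<^sub>K" "norm a ^ 2 = 1 + v * norm c ^ 2" "c \<noteq> 0"
    have "b \<le> norm a ^ 2 - 1"
      using gap[OF ac] ac(3) by simp
    then have "b * (1 + b) \<le> (norm a ^ 2 - 1) * norm a ^ 2"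
      using b(1) by (intro mult_mono) auto
    then have "b * (1 + b) * (2 - p) \<le> (norm a ^ 2 - 1) * norm a ^ 2 * (2 - p)"
      using b(3) by (intro mult_right_mono) auto
    also have "\<dots> = 4 * ((norm a ^ 2 - 1) * norm a ^ 2) * sin (pi / m) ^ 2"
      unfolding cos_sin_half_angle(2)[OF p_def, symmetric] by simp
    finally show "norm a\<^sub>0 ^ 2 - 1 < 4 * ((norm a ^ 2 - 1) * norm a ^ 2) * sin (pi / m) ^ 2"
      using b(2) by linarith
  qed (use assms in auto)
  then show ?thesis
    by (rule triangle_lattice.triangle_group_Gamma)
qed

end

section \<open>Explicit generators for each form parameter\<close>

lemma norm_of_real_power2: "norm (complex_of_real x) ^ 2 = x\<^sup>2"
  by simp

lemma triangle_group_18: "triangle_group (pgl_image (Gamma 18 (of_real (p18 * (p18 + 2))))) 2 3 18"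
proof -
  interpret cyclotomic_conjugates 18 p18 "{p18\<^sup>2 - p18 - 2, 2 - p18\<^sup>2}"
    by (rule conjugates_18)
  interpret lorentz_lattice 18 p18 "{p18\<^sup>2 - p18 - 2, 2 - p18\<^sup>2}" "p18 * (p18 + 2)" "\<lambda>x. x * (x + 2)" 1
  proof
    show "int_fun (\<lambda>x. x * (x + 2))"
      by (intro int_fun_intros)
    show "s * (s + 2) < 0" if "s \<in> {p18\<^sup>2 - p18 - 2, 2 - p18\<^sup>2}" for s
      using that p18_bounds p18_square_bounds by (auto intro!: mult_neg_pos)
  qed (use p18_bounds in auto)
  have n: "norm (complex_of_real (p18 + 1)) ^ 2 = p18\<^sup>2 + 2 * p18 + 1"
    unfolding norm_of_real_power2 by (simp add: power2_eq_square algebra_simps)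
  show ?thesis
  \<comment> \<open>With \<open>c\<^sub>0 = 1\<close> the column equation holds because
    \<open>1 + p18 * (p18 + 2)\<close> is a perfect square.\<close>
  proof (rule triangle_group_2_3[where a\<^sub>0 = "of_real (p18 + 1)" and c\<^sub>0 = 1 and \<kappa> = 1])
    show "norm (complex_of_real (p18 + 1)) ^ 2 = 1 + p18 * (p18 + 2) * norm (1::complex) ^ 2"
      unfolding n by (simp add: power2_eq_square algebra_simps)
    have "(p18\<^sup>2 + 2 * p18 + 1) * (2 - p18) = 2 + 3 * p18 - p18 ^ 3"
      by (simp add: algebra_simps eval_nat_numeral)
    then show "norm (complex_of_real (p18 + 1)) ^ 2 * (2 - p18) = 1"
      unfolding n p18_cubic by simp
    show "norm (complex_of_real (p18 + 1)) ^ 2 < 12"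
      unfolding n using p18_bounds p18_square_bounds by simp
    show "of_real (p18 + 1) \<in> O\<^sub>K" "1 * of_real (p18 * (p18 + 2)) * cnj 1 \<in> O\<^sub>K"
      using of_real_p_in_ring by (auto intro!: int_ring_gen_intros)
  qed auto
qed

lemma triangle_group_14: "triangle_group (pgl_image (Gamma 14 (of_real (p14 - 1)))) 2 3 14"
proof -
  interpret cyclotomic_conjugates 14 p14 "{p14\<^sup>2 - p14 - 1, 2 - p14\<^sup>2}"
    by (rule conjugates_14)
  interpret lorentz_lattice 14 p14 "{p14\<^sup>2 - p14 - 1, 2 - p14\<^sup>2}" "p14 - 1" "\<lambda>x. x - 1" 1
  proof
    show "int_fun (\<lambda>x. x - 1)"
      by (intro int_fun_intros)
  qed (use p14_bounds p14_square_bounds in auto)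
  have n: "norm (complex_of_real (p14\<^sup>2 - 1)) ^ 2 = p14\<^sup>2 + p14"
  proof -
    have "norm (complex_of_real (p14\<^sup>2 - 1)) ^ 2 = p14 ^ 4 - 2 * p14\<^sup>2 + 1"
      unfolding norm_of_real_power2 by (simp add: algebra_simps eval_nat_numeral)
    then show ?thesis
      unfolding p14_power4 by simp
  qed
  have n': "(p14\<^sup>2 + p14) * (2 - p14) = 1"
  proof -
    have "(p14\<^sup>2 + p14) * (2 - p14) = p14\<^sup>2 + 2 * p14 - p14 ^ 3"
      by (simp add: algebra_simps eval_nat_numeral)
    then show ?thesis
      unfolding p14_cubic by simp
  qed
  show ?thesis
  \<comment> \<open>For \<open>c\<^sub>0 = a\<^sub>0\<close> the column equation becomes
    \<open>norm a\<^sub>0 ^ 2 * (2 - p14) = 1\<close>, which is also the norm condition for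
    \<open>q = 3\<close>.\<close>
  proof (rule triangle_group_2_3[where a\<^sub>0 = "of_real (p14\<^sup>2 - 1)" and c\<^sub>0 = "of_real (p14\<^sup>2 - 1)" and \<kappa> = 1])
    show "norm (complex_of_real (p14\<^sup>2 - 1)) ^ 2 = 1 + (p14 - 1) * norm (complex_of_real (p14\<^sup>2 - 1)) ^ 2"
      unfolding n using n' by (simp add: algebra_simps)
    show "norm (complex_of_real (p14\<^sup>2 - 1)) ^ 2 * (2 - p14) = 1"
      unfolding n by (rule n')
    show "norm (complex_of_real (p14\<^sup>2 - 1)) ^ 2 < 12"
      unfolding n using p14_bounds p14_square_bounds by simp
    show "complex_of_real (p14\<^sup>2 - 1) \<noteq> 0"
      unfolding of_real_eq_0_iff using p14_square_bounds by simp
    show "of_real (p14\<^sup>2 - 1) \<in> O\<^sub>K" "of_real (p14\<^sup>2 - 1) \<in> O\<^sub>K"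
      "1 * of_real (p14 - 1) * cnj (of_real (p14\<^sup>2 - 1)) \<in> O\<^sub>K"
      using of_real_p_in_ring by (auto intro!: int_ring_gen_intros)
  qed auto
qed

lemma triangle_group_12: "triangle_group (pgl_image (Gamma 12 (of_real ((p12 - 1) / 2)))) 2 3 12"
proof -
  interpret cyclotomic_conjugates 12 p12 "{- p12}"
    by (rule conjugates_12)
  interpret lorentz_lattice 12 p12 "{- p12}" "(p12 - 1) / 2" "\<lambda>x. x - 1" 2
  proof
    show "int_fun (\<lambda>x. x - 1)"
      by (intro int_fun_intros)
  qed (use p12_bounds in auto)
  let ?z = "zeta 12"
  have z: "?z * cnj ?z = 1" by simp
  have z3: "?z ^ 3 = \<i>"
    by (simp add: zeta_cis Complex.DeMoivre complex_eq_iff)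
  have p: "of_real p12 = ?z + cnj ?z"
    unfolding zeta_add_cnj p12_def by simp
  \<comment> \<open>The form parameter is not an algebraic integer, but its product with
    \<open>1 - \<i>\<close> lies in the ring. Hence the factor \<open>1 + ?z ^ 3 = 1 + \<i>\<close>
    of \<open>c\<^sub>0\<close> below.\<close>
  have w: "of_real ((p12 - 1) / 2) * (1 - \<i>) = ?z - ?z ^ 2"
  proof -
    have eq: "?z = of_real (p12 / 2) + \<i> / 2"
      using sin_30 by (simp add: zeta_cis p12_def complex_eq_iff)
    have "?z - ?z ^ 2 = of_real (p12 / 2 - p12\<^sup>2 / 4 + 1 / 4) + \<i> * of_real (1 / 2 - p12 / 2)"
      unfolding eq by (simp add: power2_eq_square complex_eq_iff algebra_simps)
    also have "\<dots> = of_real ((p12 - 1) / 2) * (1 - \<i>)"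
      unfolding p12_square by (simp add: complex_eq_iff diff_divide_distrib)
    finally show ?thesis ..
  qed
  have nc: "norm ((1 + ?z ^ 3) * (1 + ?z)) ^ 2 = 2 * (2 + p12)"
    unfolding norm_mult power_mult_distrib norm_one_plus_zeta z3 by (simp add: cmod_power2)
  show ?thesis
  \<comment> \<open>\<open>norm (1 + ?z) ^ 2 = 2 + p12\<close> is the inverse of
    \<open>2 - p12\<close> because \<open>p12\<^sup>2 = 3\<close>; the phase of
    \<open>1 + ?z\<close> is compensated by \<open>\<kappa> = ?z\<close>.\<close>
  proof (rule triangle_group_2_3[where a\<^sub>0 = "1 + ?z" and c\<^sub>0 = "(1 + ?z ^ 3) * (1 + ?z)" and \<kappa> = ?z])
    show "1 + ?z \<in> O\<^sub>K" "(1 + ?z ^ 3) * (1 + ?z) \<in> O\<^sub>K"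
      by (auto intro!: int_ring_gen_intros)
    have "?z * V * cnj ((1 + ?z ^ 3) * (1 + ?z)) = (V * (1 - \<i>)) * (?z + ?z * cnj ?z)" for V
      unfolding z3 by (simp add: algebra_simps)
    then have "?z * of_real ((p12 - 1) / 2) * cnj ((1 + ?z ^ 3) * (1 + ?z))
        = (of_real ((p12 - 1) / 2) * (1 - \<i>)) * (?z + ?z * cnj ?z)" .
    also have "\<dots> = (?z - ?z ^ 2) * (?z + 1)"
      unfolding w z ..
    finally show "?z * of_real ((p12 - 1) / 2) * cnj ((1 + ?z ^ 3) * (1 + ?z)) \<in> O\<^sub>K"
      by (auto intro!: int_ring_gen_intros)
    show "?z * cnj (1 + ?z) = 1 + ?z"
      using z by (simp add: algebra_simps)
    show "norm (1 + ?z) ^ 2 = 1 + (p12 - 1) / 2 * norm ((1 + ?z ^ 3) * (1 + ?z)) ^ 2"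
      unfolding nc norm_one_plus_zeta using p12_square by (simp add: power2_eq_square field_simps)
    show "(1 + ?z ^ 3) * (1 + ?z) \<noteq> 0"
      using nc p12_bounds by auto
    show "norm (1 + ?z) ^ 2 * (2 - p12) = 1"
      unfolding norm_one_plus_zeta using p12_square by (simp add: power2_eq_square algebra_simps)
    show "norm (1 + ?z) ^ 2 < 12"
      unfolding norm_one_plus_zeta using p12_bounds by simp
  qed auto
qed

lemma triangle_group_12_12: "triangle_group (pgl_image (Gamma 12 (of_real (2 * p12 * (p12 + 2))))) 2 12 12"
proof -
  interpret cyclotomic_conjugates 12 p12 "{- p12}"
    by (rule conjugates_12)
  interpret lorentz_lattice 12 p12 "{- p12}" "2 * p12 * (p12 + 2)" "\<lambda>x. 2 * x * (x + 2)" 1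
  proof
    show "int_fun (\<lambda>x. 2 * x * (x + 2))"
      by (intro int_fun_intros)
    show "2 * s * (s + 2) < 0" if "s \<in> {- p12}" for s
      using that p12_bounds by (auto intro!: mult_pos_pos)
  qed (use p12_bounds in auto)
  have v: "2 * p12 * (p12 + 2) = 6 + 4 * p12"
    using p12_square by (simp add: power2_eq_square algebra_simps)
  have n: "norm (complex_of_real (p12 + 2)) ^ 2 = 7 + 4 * p12"
    unfolding norm_of_real_power2 using p12_square by (simp add: power2_eq_square algebra_simps)
  show ?thesis
  \<comment> \<open>The value 8 suffices since \<open>8 * 9 * (2 - p12)\<close> exceeds 18, whereas
    \<open>norm a\<^sub>0 ^ 2 - 1 = 6 + 4 * p12\<close> is below 13.\<close>
  proof (rule triangle_group_2_m[where a\<^sub>0 = "of_real (p12 + 2)" and c\<^sub>0 = 1 and \<kappa> = 1 and b = 8])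
    fix a c
    assume ac: "a \<in> O\<^sub>K" "c \<in> O\<^sub>K" "norm a ^ 2 = 1 + 2 * p12 * (p12 + 2) * norm c ^ 2" "c \<noteq> 0"
    obtain h k where hk: "int_fun h" "int_fun k" "h p12 = norm a ^ 2" "k p12 = norm c ^ 2"
      "\<forall>s\<in>{- p12}. 0 \<le> h s \<and> h s \<le> 1 \<and> 0 \<le> k s \<and> real 1 * (h s - 1) = 2 * s * (s + 2) * k s"
      by (rule column_conjugates[OF ac(1-3)])
    have v': "2 * (- p12) * (- p12 + 2) = 6 - 4 * p12"
      using p12_square by (simp add: power2_eq_square algebra_simps)
    have k: "0 \<le> k (- p12)" "(4 * p12 - 6) * k (- p12) \<le> 1"
      using bspec[OF hk(5) singletonI] unfolding v' by (auto simp: algebra_simps)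
    \<comment> \<open>\<open>23 / 25\<close> is \<open>4 * 1.73 - 6\<close>. An upper bound for the
      conjugate of \<open>norm c ^ 2\<close> gives, through the norm, a lower bound for
      \<open>norm c ^ 2\<close> itself.\<close>
    have "23 / 25 * k (- p12) \<le> (4 * p12 - 6) * k (- p12)"
      using k(1) p12_bounds by (intro mult_right_mono) auto
    then have k': "k (- p12) \<le> 11 / 10"
      using k(2) by linarith
    have "1 \<le> norm c ^ 2 * k (- p12)"
      using norm_ge_1[OF hk(2)] ac(4) hk(4) k(1) by simp
    also have "\<dots> \<le> norm c ^ 2 * (11 / 10)"
      using k' by (intro mult_left_mono) auto
    finally have "norm c ^ 2 \<ge> 10 / 11" by simp
    then have "12 * (10 / 11) \<le> (6 + 4 * p12) * norm c ^ 2"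
      using p12_bounds by (intro mult_mono) auto
    then show "8 \<le> 2 * p12 * (p12 + 2) * norm c ^ 2"
      unfolding v by linarith
  next
    show "norm (complex_of_real (p12 + 2)) ^ 2 = 1 + 2 * p12 * (p12 + 2) * norm (1::complex) ^ 2"
      unfolding n v by simp
    show "norm (complex_of_real (p12 + 2)) ^ 2 * (2 - p12) = 2 + p12"
      unfolding n using p12_square by (simp add: power2_eq_square algebra_simps)
    show "norm (complex_of_real (p12 + 2)) ^ 2 - 1 < 8 * (1 + 8) * (2 - p12)"
      unfolding n using p12_bounds by simp
    show "of_real (p12 + 2) \<in> O\<^sub>K" "1 * of_real (2 * p12 * (p12 + 2)) * cnj 1 \<in> O\<^sub>K"
      using of_real_p_in_ring by (auto intro!: int_ring_gen_intros)
  qed (use p12_bounds in auto)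
qed

lemma triangle_group_10_10: "triangle_group (pgl_image (Gamma 10 (of_real (2 * p10 ^ 3)))) 2 10 10"
proof -
  interpret cyclotomic_conjugates 10 p10 "{1 - p10}"
    by (rule conjugates_10)
  interpret lorentz_lattice 10 p10 "{1 - p10}" "2 * p10 ^ 3" "\<lambda>x. 2 * x ^ 3" 1
  proof
    show "int_fun (\<lambda>x. 2 * x ^ 3)"
      by (intro int_fun_intros)
    show "2 * s ^ 3 < 0" if "s \<in> {1 - p10}" for s
      using that p10_bounds by simp
  qed (use p10_bounds in auto)
  have cube: "x ^ 3 = 2 * x + 1" if "x\<^sup>2 = x + 1" for x :: real
  proof -
    have "x ^ 3 = x * x\<^sup>2" by (simp add: eval_nat_numeral)
    also have "\<dots> = x\<^sup>2 + x" by (subst that) (simp add: algebra_simps power2_eq_square)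
    finally show ?thesis using that by simp
  qed
  have v: "2 * p10 ^ 3 = 4 * p10 + 2"
    using cube[OF p10_square] by simp
  have "(1 - p10)\<^sup>2 = (1 - p10) + 1"
    using p10_square by (simp add: power2_eq_square algebra_simps)
  then have v': "2 * (1 - p10) ^ 3 = 6 - 4 * p10"
    using cube by simp
  let ?z = "zeta 10"
  have z: "?z * cnj ?z = 1" by simp
  have n: "norm (of_real p10 * (1 + ?z)) ^ 2 = 4 * p10 + 3"
    unfolding norm_mult power_mult_distrib norm_one_plus_zeta norm_of_real_power2
    using p10_square by (simp add: algebra_simps power2_eq_square)
  show ?thesis
  \<comment> \<open>The factor \<open>1 + ?z\<close> supplies \<open>2 + p10\<close>, and
    \<open>p10\<^sup>2 * (2 + p10) = 4 * p10 + 3\<close> is \<open>1 + 2 * p10 ^ 3\<close>, so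
    \<open>c\<^sub>0 = 1\<close> is possible.\<close>
  proof (rule triangle_group_2_m[where a\<^sub>0 = "of_real p10 * (1 + ?z)" and c\<^sub>0 = 1 and \<kappa> = ?z and b = 8])
    fix a c
    assume ac: "a \<in> O\<^sub>K" "c \<in> O\<^sub>K" "norm a ^ 2 = 1 + 2 * p10 ^ 3 * norm c ^ 2" "c \<noteq> 0"
    obtain h k where hk: "int_fun h" "int_fun k" "h p10 = norm a ^ 2" "k p10 = norm c ^ 2"
      "\<forall>s\<in>{1 - p10}. 0 \<le> h s \<and> h s \<le> 1 \<and> 0 \<le> k s \<and> real 1 * (h s - 1) = 2 * s ^ 3 * k s"
      by (rule column_conjugates[OF ac(1-3)])
    let ?k = "k (1 - p10)"
    have k: "0 \<le> ?k" "(4 * p10 - 6) * ?k \<le> 1"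
      using bspec[OF hk(5) singletonI] unfolding v' by (auto simp: algebra_simps)
    \<comment> \<open>\<open>11 / 25\<close> is \<open>4 * 1.61 - 6\<close>. The resulting bound
      10/23 for \<open>norm c ^ 2\<close> is too weak for \<open>b = 8\<close> and is raised to 1
      afterwards.\<close>
    have "11 / 25 * ?k \<le> (4 * p10 - 6) * ?k"
      using k(1) p10_bounds by (intro mult_right_mono) auto
    then have k': "?k \<le> 23 / 10"
      using k(2) by linarith
    have "1 \<le> norm c ^ 2 * ?k"
      using norm_ge_1[OF hk(2)] ac(4) hk(4) k(1) by simp
    also have "\<dots> \<le> norm c ^ 2 * (23 / 10)"
      using k' by (intro mult_left_mono) auto
    finally have c: "norm c ^ 2 \<ge> 10 / 23" by simp
    \<comment> \<open>If \<open>norm c ^ 2 < 1\<close>, then the norm of \<open>1 - norm c ^ 2\<close> is less than \<open>1\<close>.\<close>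
    have "norm c ^ 2 \<ge> 1"
    proof (rule ccontr)
      assume less: "\<not> norm c ^ 2 \<ge> 1"
      have "1 \<le> \<bar>1 - k p10\<bar> * (\<Prod>s\<in>{1 - p10}. \<bar>1 - k s\<bar>)"
        using less hk(4) by (intro norm_ge_1[of "\<lambda>x. 1 - k x"] int_fun_intros hk(2)) auto
      then have "1 \<le> \<bar>1 - norm c ^ 2\<bar> * \<bar>1 - ?k\<bar>"
        using hk(4) by simp
      also have "\<dots> \<le> 13 / 23 * (13 / 10)"
      proof (rule mult_mono)
        show "\<bar>1 - norm c ^ 2\<bar> \<le> 13 / 23" "\<bar>1 - ?k\<bar> \<le> 13 / 10"
          using less c k(1) k' by linarith+
      qed auto
      finally show False by simp
    qed
    then have "8 * 1 \<le> (4 * p10 + 2) * norm c ^ 2"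
      using p10_bounds by (intro mult_mono) auto
    then show "8 \<le> 2 * p10 ^ 3 * norm c ^ 2"
      unfolding v by linarith
  next
    show "norm (of_real p10 * (1 + ?z)) ^ 2 = 1 + 2 * p10 ^ 3 * norm (1::complex) ^ 2"
      unfolding n v by simp
    show "norm (of_real p10 * (1 + ?z)) ^ 2 * (2 - p10) = 2 + p10"
      unfolding n using p10_square by (simp add: power2_eq_square algebra_simps)
    show "norm (of_real p10 * (1 + ?z)) ^ 2 - 1 < 8 * (1 + 8) * (2 - p10)"
      unfolding n using p10_bounds by simp
    show "?z * cnj (of_real p10 * (1 + ?z)) = of_real p10 * (1 + ?z)"
      using z by (simp add: algebra_simps)
    show "of_real p10 * (1 + ?z) \<in> O\<^sub>K" "?z * of_real (2 * p10 ^ 3) * cnj 1 \<in> O\<^sub>K"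
      using of_real_p_in_ring by (auto intro!: int_ring_gen_intros)
  qed (use p10_bounds in auto)
qed

theorem theorem3p6:
  fixes p1 :: "nat \<Rightarrow> complex" and p5 :: "nat \<Rightarrow> complex"
  defines "p1 \<equiv> \<lambda>m. zeta m + cnj (zeta m)"
      and "p5 \<equiv> \<lambda>m. zeta m ^ 5 + cnj (zeta m ^ 5)"
  shows "triangle_group (pgl_image (Gamma 12 (2 * p1 12 * (p1 12 + 2)))) 2 12 12
       \<and> triangle_group (pgl_image (Gamma 10 (2 * p1 10 ^ 3))) 2 10 10
       \<and> triangle_group (pgl_image (Gamma 18 (p1 18 * (p1 18 + 2)))) 2 3 18
       \<and> triangle_group (pgl_image (Gamma 14 (inverse (- p5 14)))) 2 3 14
       \<and> triangle_group (pgl_image (Gamma 12 (inverse (p1 12 + 1)))) 2 3 12"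
proof -
  have p1: "p1 10 = of_real p10" "p1 12 = of_real p12" "p1 18 = of_real p18"
    by (simp_all only: p1_def zeta_add_cnj p10_def p12_def p18_def of_nat_numeral)
  have "p5 14 = of_real (2 * cos (5 * (2 * pi / real 14)))"
    by (simp add: p5_def zeta_cis Complex.DeMoivre complex_eq_iff)
  \<comment> \<open>The supplementary angle is twice 2 pi / 14, so the duplication formula expresses
    \<open>p5 14\<close> through \<open>p14\<close>.\<close>
  also have "cos (5 * (2 * pi / real 14)) = cos (pi - 2 * (2 * pi / real 14))"
    by (rule arg_cong[of _ _ cos]) simp
  also have "2 * cos (pi - 2 * (2 * pi / real 14)) = 2 - p14\<^sup>2"
    unfolding cos_pi_minus cos_double_cos p14_def by (simp add: power2_eq_square)
  finally have p5: "p5 14 = of_real (2 - p14\<^sup>2)" .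
  have "(p14\<^sup>2 - 2) * (p14 - 1) = 1"
    using p14_cubic by (simp add: algebra_simps eval_nat_numeral)
  then have "complex_of_real ((p14\<^sup>2 - 2) * (p14 - 1)) = of_real 1"
    by (simp only:)
  then have w14: "inverse (- p5 14) = of_real (p14 - 1)"
    unfolding p5 by (intro inverse_unique) simp
  have "(p12 + 1) * ((p12 - 1) / 2) = 1"
    using p12_square by (simp add: power2_eq_square algebra_simps)
  then have "complex_of_real ((p12 + 1) * ((p12 - 1) / 2)) = of_real 1"
    by (simp only:)
  then have w12: "inverse (p1 12 + 1) = of_real ((p12 - 1) / 2)"
    unfolding p1 by (intro inverse_unique) simp
  show ?thesis
    unfolding w14 w12 unfolding p1
    using triangle_group_12_12 triangle_group_10_10 triangle_group_18 triangle_group_14 triangle_group_12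
    by simp
qed

end
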